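(* If the characteristic of $k$ is different from $p$, then hypothesis (sur) holds true, i.e. the map $\rho:\mathbf X^*\to H^*=H$ dual to the inclusion $H=\mathbf X^I\subseteq\mathbf X$ is surjective.
   Context: Setting. $\mathfrak F$ is a locally compact nonarchimedean field of any characteristic, with ring of integers $\mathfrak O$, prime element $\pi$ and residue field $\mathbb F_q$ of characteristic $p$; $\mathbf G$ is a connected reductive $\mathfrak F$-split group over $\mathfrak F$, $G=\mathbf G(\mathfrak F)$. Fix a chamber $C$ of the semisimple Bruhat–Tits building of $G$ and a hyperspecial vertex $x_0$ of $C$. Let $\mathbf G_{x_0}$ be the Bruhat–Tits group scheme over $\mathfrak O$ attached to $x_0$ (generic fibre $\mathbf G$; special fibre $\overline{\mathbf G}_{x_0}$ connected reductive and $\mathbb F_q$-split) and $K=\mathbf G_{x_0}(\mathfrak O)$. The pointwise stabilizer $J\subseteq K$ of $C$ is an Iwahori subgroup; it corresponds to a Borel subgroup $\overline{\mathbf B}$ of $\overline{\mathbf G}_{x_0}$ with unipotent radical $\overline{\mathbf N}$. Let $I$ be the preimage of $\overline{\mathbf N}(\mathbb F_q)$ in $K$ (the pro-$p$-Iwahori subgroup). $k$ is a field. $\mathbf X=\mathrm{ind}_I^G(1)$ is the space of compactly supported $k$-valued functions on $G/I$ with the left translation action of $G$, and $H=\mathrm{End}_{k[G]}(\mathbf X)^{\mathrm{op}}$, so $\mathbf X$ is a $(G,H)$-bimodule. $H$ is identified, as a right $H$-module, with $\mathbf X^I\subseteq\mathbf X$ via $h\mapsto(\mathrm{char}_I)h$.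 For a right $H$-module $Y$, $Y^*=\mathrm{Hom}_H(Y,H)$, a left $H$-module. *)

theory Defs
  imports
    "HOL-Analysis.Analysis"
    "HOL-Algebra.Algebra"
    "HOL-Algebra.Algebraic_Closure_Type"
    "HOL-Algebra.Left_Coset"
    "HOL-Library.Poly_Mapping"
begin

section \<open>Polynomials in the matrix entries\<close>

type_synonym ('n, 'a) mat_poly = "(('n \<times> 'n) \<Rightarrow>\<^sub>0 nat) \<Rightarrow>\<^sub>0 'a"

definition mat_eval :: "('n::finite, 'a::comm_ring_1) mat_poly \<Rightarrow> 'a^'n^'n \<Rightarrow> 'a" where
  "mat_eval f A =
     (\<Sum>m\<in>Poly_Mapping.keys f. Poly_Mapping.lookup f m *
        (\<Prod>(i,j)\<in>Poly_Mapping.keys m. (A $ i $ j) ^ Poly_Mapping.lookup m (i,j)))"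

definition det_poly :: "('n::finite, 'a::comm_ring_1) mat_poly" where
  "det_poly = det (\<chi> i j. Poly_Mapping.single (Poly_Mapping.single (i,j) 1) 1)"

definition poly_ideal :: "('n::finite, 'a::comm_ring_1) mat_poly set \<Rightarrow> ('n, 'a) mat_poly set" where
  "poly_ideal P = Modules.module.span (*) P"

section \<open>Linear algebraic groups\<close>

text \<open>
  A linear algebraic group over a field \<open>F\<close> is given, as in the textbooks of Borel, Humphreys
  and Springer, by its set of points in \<open>GL_n\<close> of an algebraic closure.  Inclusions
  of \<open>F\<close> into the algebraically closed field are passed as a parameter \<open>h\<close>.
\<close>

definition GL :: "('a::field^'n::finite^'n) monoid" where
  "GL = \<lparr>carrier = {A. invertible A}, monoid.mult = (**), one = mat 1\<rparr>"

definition zariski :: "('a::alg_closed_field^'n::finite^'n) topology" where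
  "zariski = topology_generated_by (range (\<lambda>f. {A. mat_eval f A \<noteq> 0}))"

definition alg_group :: "('a::alg_closed_field^'n::finite^'n) set \<Rightarrow> bool" where
  "alg_group S \<longleftrightarrow> subgroup S GL \<and> closedin (subtopology zariski (carrier GL)) S"

definition conn_alg_group :: "('a::alg_closed_field^'n::finite^'n) set \<Rightarrow> bool" where
  "conn_alg_group S \<longleftrightarrow> alg_group S \<and> connectedin zariski S"

text \<open>
  The equations \<open>P\<close> define inside the scheme \<open>GL_n\<close> a \<^emph>\<open>reduced\<close> closed subscheme with set of
  points \<open>S\<close>: in \<open>K[x_ij, 1/det]\<close> they generate the full vanishing ideal of \<open>S\<close>.
\<close>
definition reduced_equations ::
  "('n::finite, 'a::alg_closed_field) mat_poly set \<Rightarrow> ('a^'n^'n) set \<Rightarrow> bool" where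
  "reduced_equations P S \<longleftrightarrow>
     S = {A. invertible A \<and> (\<forall>f\<in>P. mat_eval f A = 0)} \<and>
     (\<forall>g. (\<forall>A\<in>S. mat_eval g A = 0) \<longrightarrow> (\<exists>m. det_poly ^ m * g \<in> poly_ideal P))"

text \<open>
  As the vanishing ideal is required to be generated over the small field, this also gives the
  correct (geometrically reduced, i.e. smooth) notion over imperfect fields.
\<close>
definition defined_over ::
  "('b::field \<Rightarrow> 'a::alg_closed_field) \<Rightarrow> ('a^'n::finite^'n) set \<Rightarrow> bool" where
  "defined_over h S \<longleftrightarrow> (\<exists>P. reduced_equations (Poly_Mapping.map h ` P) S)"

definition rational_points ::
  "('b::field \<Rightarrow> 'a::alg_closed_field) \<Rightarrow> ('a^'n::finite^'n) set \<Rightarrow> ('b^'n^'n) set" where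
  "rational_points h S = {A. map_matrix h A \<in> S}"

definition unipotent :: "'a::field^'n::finite^'n \<Rightarrow> bool" where
  "unipotent A \<longleftrightarrow> (\<exists>m. (((**) (A - mat 1)) ^^ m) (mat 1) = 0)"

definition normal_unipotent :: "('a::alg_closed_field^'n::finite^'n) set \<Rightarrow> ('a^'n^'n) set \<Rightarrow> bool" where
  "normal_unipotent U S \<longleftrightarrow>
     conn_alg_group U \<and> U \<lhd> (GL\<lparr>carrier := S\<rparr>) \<and> (\<forall>A\<in>U. unipotent A)"

definition unipotent_radical :: "('a::alg_closed_field^'n::finite^'n) set \<Rightarrow> ('a^'n^'n) set \<Rightarrow> bool" where
  "unipotent_radical U S \<longleftrightarrow>
     normal_unipotent U S \<and> (\<forall>V. normal_unipotent V S \<longrightarrow> V \<subseteq> U)"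

definition conn_reductive :: "('a::alg_closed_field^'n::finite^'n) set \<Rightarrow> bool" where
  "conn_reductive S \<longleftrightarrow> conn_alg_group S \<and> unipotent_radical {mat 1} S"

definition split_torus ::
  "('b::field \<Rightarrow> 'a::alg_closed_field) \<Rightarrow> ('a^'n::finite^'n) set \<Rightarrow> bool" where
  "split_torus h T \<longleftrightarrow> conn_alg_group T \<and>
     (\<exists>g::'b^'n^'n. invertible g \<and>
        (\<forall>t\<in>T. \<forall>i j. i \<noteq> j \<longrightarrow>
           (map_matrix h g ** t ** matrix_inv (map_matrix h g)) $ i $ j = 0))"

definition torus :: "('a::alg_closed_field^'n::finite^'n) set \<Rightarrow> bool" where
  "torus T \<longleftrightarrow> split_torus (\<lambda>x. x) T"

definition maximal_torus :: "('a::alg_closed_field^'n::finite^'n) set \<Rightarrow> ('a^'n^'n) set \<Rightarrow> bool" where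
  "maximal_torus T S \<longleftrightarrow> torus T \<and> T \<subseteq> S \<and>
     (\<forall>T'. torus T' \<and> T \<subseteq> T' \<and> T' \<subseteq> S \<longrightarrow> T' = T)"

definition split_reductive ::
  "('b::field \<Rightarrow> 'a::alg_closed_field) \<Rightarrow> ('a^'n::finite^'n) set \<Rightarrow> bool" where
  "split_reductive h S \<longleftrightarrow> conn_reductive S \<and> defined_over h S \<and>
     (\<exists>T. maximal_torus T S \<and> split_torus h T)"

definition borel_subgroup :: "('a::alg_closed_field^'n::finite^'n) set \<Rightarrow> ('a^'n^'n) set \<Rightarrow> bool" where
  "borel_subgroup B S \<longleftrightarrow>
     conn_alg_group B \<and> solvable (GL\<lparr>carrier := B\<rparr>) \<and> B \<subseteq> S \<and>
     (\<forall>B'. conn_alg_group B' \<and> solvable (GL\<lparr>carrier := B'\<rparr>) \<and> B \<subseteq> B' \<and> B' \<subseteq> S \<longrightarrow> B' = B)"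

section \<open>Nonarchimedean local fields\<close>

definition local_field :: "('f::field \<Rightarrow> real) \<Rightarrow> bool" where
  "local_field v \<longleftrightarrow>
     (\<forall>x. v x \<ge> 0) \<and> (\<forall>x. v x = 0 \<longleftrightarrow> x = 0) \<and>
     (\<forall>x y. v (x * y) = v x * v y) \<and> (\<forall>x y. v (x + y) \<le> max (v x) (v y)) \<and>
     (\<exists>x. x \<noteq> 0 \<and> v x \<noteq> 1) \<and>
     locally_compact_space (Metric_space.mtopology UNIV (\<lambda>x y. v (x - y)))"

definition integers :: "('f::field \<Rightarrow> real) \<Rightarrow> 'f set" where
  "integers v = {x. v x \<le> 1}"

text \<open>
  The finite field \<open>'q\<close> is the residue field, via the map \<open>red\<close>; the values of \<open>red\<close> outside
  the ring of integers are irrelevant.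
\<close>
definition residue_map :: "('f::field \<Rightarrow> real) \<Rightarrow> ('f \<Rightarrow> 'q::field) \<Rightarrow> bool" where
  "residue_map v red \<longleftrightarrow>
     red ` integers v = UNIV \<and> red 1 = 1 \<and>
     (\<forall>x\<in>integers v. \<forall>y\<in>integers v. red (x + y) = red x + red y \<and> red (x * y) = red x * red y) \<and>
     (\<forall>x\<in>integers v. red x = 0 \<longleftrightarrow> v x < 1)"

section \<open>Hyperspecial points and pro-p-Iwahori subgroups\<close>

text \<open>
  Let \<open>G\<close> be a closed subgroup of \<open>GL_n\<close> defined over the local field \<open>F\<close>, with ring of integers
  \<open>O\<close>.  Its schematic closure in \<open>GL_n\<close> over \<open>O\<close> is a flat closed subgroup scheme with generic fibre
  \<open>G\<close>, whose ideal is generated by \<open>integral_equations\<close>.  Conversely every flat affine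
  \<open>O\<close>-group scheme of finite type with generic fibre \<open>G\<close> is of this form, for a suitable choice
  of \<open>n\<close> and of the embedding of \<open>G\<close>.

  The Bruhat-Tits group schemes attached to the hyperspecial vertices of the semisimple building of
  a split group \<open>G\<close> are exactly the smooth affine \<open>O\<close>-group schemes with generic fibre \<open>G\<close> and
  connected reductive special fibre (which then is split).  A hyperspecial vertex \<open>x\<close> is therefore
  encoded by an embedding of \<open>G\<close> whose schematic closure is such a scheme \<open>G_x\<close>, and a chamber
  containing \<open>x\<close> by the corresponding Borel subgroup of the special fibre of \<open>G_x\<close>.
\<close>

definition integral_equations ::
  "('f::field \<Rightarrow> real) \<Rightarrow> ('f alg_closure^'n::finite^'n) set \<Rightarrow> ('n, 'f) mat_poly set" where
  "integral_equations v G =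
     {f. (\<forall>m. Poly_Mapping.lookup f m \<in> integers v) \<and>
         (\<forall>A\<in>G. mat_eval (Poly_Mapping.map to_ac f) A = 0)}"

definition special_equations ::
  "('f::field \<Rightarrow> real) \<Rightarrow> ('f \<Rightarrow> 'q::field) \<Rightarrow> ('f alg_closure^'n::finite^'n) set \<Rightarrow>
   ('n, 'q alg_closure) mat_poly set" where
  "special_equations v red G =
     Poly_Mapping.map (\<lambda>c. to_ac (red c)) ` integral_equations v G"

definition special_fibre ::
  "('f::field \<Rightarrow> real) \<Rightarrow> ('f \<Rightarrow> 'q::field) \<Rightarrow> ('f alg_closure^'n::finite^'n) set \<Rightarrow>
   ('q alg_closure^'n^'n) set" where
  "special_fibre v red G =
     {A. invertible A \<and> (\<forall>f\<in>special_equations v red G. mat_eval f A = 0)}"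

text \<open>
  Reducedness of the special fibre over the algebraic closure amounts to smoothness of the model.
\<close>
definition hyperspecial_model ::
  "('f::field \<Rightarrow> real) \<Rightarrow> ('f \<Rightarrow> 'q::field) \<Rightarrow> ('f alg_closure^'n::finite^'n) set \<Rightarrow> bool" where
  "hyperspecial_model v red G \<longleftrightarrow>
     reduced_equations (special_equations v red G) (special_fibre v red G) \<and>
     split_reductive to_ac (special_fibre v red G)"

definition GL_integers :: "('f::field \<Rightarrow> real) \<Rightarrow> ('f^'n::finite^'n) set" where
  "GL_integers v =
     {A. (\<forall>i j. A $ i $ j \<in> integers v) \<and>
         (\<exists>A'. (\<forall>i j. A' $ i $ j \<in> integers v) \<and> A ** A' = mat 1 \<and> A' ** A = mat 1)}"

text \<open>The group \<open>K\<close> of \<open>O\<close>-points of the schematic closure of \<open>G\<close> in \<open>GL_n\<close>.\<close>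
definition integral_points ::
  "('f::field \<Rightarrow> real) \<Rightarrow> ('f alg_closure^'n::finite^'n) set \<Rightarrow> ('f^'n^'n) set" where
  "integral_points v G = rational_points to_ac G \<inter> GL_integers v"

text \<open>Here \<open>N\<close> is the unipotent radical of a Borel subgroup of the special fibre.\<close>
definition pro_p_iwahori ::
  "('f::field \<Rightarrow> real) \<Rightarrow> ('f \<Rightarrow> 'q::field) \<Rightarrow> ('f alg_closure^'n::finite^'n) set \<Rightarrow>
   ('q alg_closure^'n^'n) set \<Rightarrow> ('f^'n^'n) set" where
  "pro_p_iwahori v red G N =
     {A \<in> integral_points v G. map_matrix red A \<in> rational_points to_ac N}"

section \<open>The universal module and its Hecke algebra\<close>

text \<open>
  In this section \<open>G\<close> is a topological group and \<open>I\<close> an open subgroup.  Since \<open>G/I\<close> is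
  discrete, compactly supported functions on it are the finitely supported ones.  They are
  extended by zero to all sets.
\<close>

definition ind_space ::
  "'k::field itself \<Rightarrow> ('g, 'm) monoid_scheme \<Rightarrow> 'g set \<Rightarrow> ('g set \<Rightarrow> 'k) set" where
  "ind_space _ G I = {f. {c. f c \<noteq> 0} \<subseteq> lcosets\<^bsub>G\<^esub> I \<and> finite {c. f c \<noteq> 0}}"

definition translate :: "('g, 'm) monoid_scheme \<Rightarrow> 'g \<Rightarrow> ('g set \<Rightarrow> 'k) \<Rightarrow> ('g set \<Rightarrow> 'k)" where
  "translate G g f = (\<lambda>c. f ((inv\<^bsub>G\<^esub> g) <#\<^bsub>G\<^esub> c))"

definition char_fun :: "'g set \<Rightarrow> ('g set \<Rightarrow> 'k::field)" where
  "char_fun I = (\<lambda>c. if c = I then 1 else 0)"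

definition ind_end ::
  "'k::field itself \<Rightarrow> ('g, 'm) monoid_scheme \<Rightarrow> 'g set \<Rightarrow> (('g set \<Rightarrow> 'k) \<Rightarrow> ('g set \<Rightarrow> 'k)) set" where
  "ind_end k G I =
     {h \<in> ind_space k G I \<rightarrow>\<^sub>E ind_space k G I.
        (\<forall>x\<in>ind_space k G I. \<forall>y\<in>ind_space k G I. h (\<lambda>c. x c + y c) = (\<lambda>c. h x c + h y c)) \<and>
        (\<forall>a. \<forall>x\<in>ind_space k G I. h (\<lambda>c. a * x c) = (\<lambda>c. a * h x c)) \<and>
        (\<forall>g\<in>carrier G. \<forall>x\<in>ind_space k G I. h (translate G g x) = translate G g (h x))}"

text \<open>
  The multiplication is opposite to composition, so that \<open>ind_space\<close> becomes a right module
  under \<open>x h = h x\<close>.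
\<close>
definition hecke ::
  "'k::field itself \<Rightarrow> ('g, 'm) monoid_scheme \<Rightarrow> 'g set \<Rightarrow> (('g set \<Rightarrow> 'k) \<Rightarrow> ('g set \<Rightarrow> 'k)) ring" where
  "hecke k G I =
     \<lparr>carrier = ind_end k G I,
      monoid.mult = (\<lambda>a b. compose (ind_space k G I) b a),
      one = (\<lambda>x\<in>ind_space k G I. x),
      ring.zero = (\<lambda>x\<in>ind_space k G I. \<lambda>c. 0),
      add = (\<lambda>a b. \<lambda>x\<in>ind_space k G I. \<lambda>c. a x c + b x c)\<rparr>"

text \<open>
  \<open>Hom_H(Y, H)\<close> for a right module \<open>Y\<close> over \<open>H\<close> with addition \<open>add_Y\<close> and scalar
  multiplication \<open>act_Y\<close>.
\<close>
definition right_dual ::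
  "('h, 'm) ring_scheme \<Rightarrow> 'y set \<Rightarrow> ('y \<Rightarrow> 'y \<Rightarrow> 'y) \<Rightarrow> ('y \<Rightarrow> 'h \<Rightarrow> 'y) \<Rightarrow> ('y \<Rightarrow> 'h) set" where
  "right_dual H Y add_Y act_Y =
     {\<phi> \<in> Y \<rightarrow>\<^sub>E carrier H.
        (\<forall>x\<in>Y. \<forall>y\<in>Y. \<phi> (add_Y x y) = \<phi> x \<oplus>\<^bsub>H\<^esub> \<phi> y) \<and>
        (\<forall>x\<in>Y. \<forall>h\<in>carrier H. \<phi> (act_Y x h) = \<phi> x \<otimes>\<^bsub>H\<^esub> h)}"

definition ind_dual ::
  "'k::field itself \<Rightarrow> ('g, 'm) monoid_scheme \<Rightarrow> 'g set \<Rightarrow>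
   (('g set \<Rightarrow> 'k) \<Rightarrow> (('g set \<Rightarrow> 'k) \<Rightarrow> ('g set \<Rightarrow> 'k))) set" where
  "ind_dual k G I =
     right_dual (hecke k G I) (ind_space k G I) (\<lambda>x y c. x c + y c) (\<lambda>x h. h x)"

definition hecke_dual ::
  "'k::field itself \<Rightarrow> ('g, 'm) monoid_scheme \<Rightarrow> 'g set \<Rightarrow>
   ((('g set \<Rightarrow> 'k) \<Rightarrow> ('g set \<Rightarrow> 'k)) \<Rightarrow> (('g set \<Rightarrow> 'k) \<Rightarrow> ('g set \<Rightarrow> 'k))) set" where
  "hecke_dual k G I =
     right_dual (hecke k G I) (carrier (hecke k G I))
       (add (hecke k G I)) (monoid.mult (hecke k G I))"

text \<open>
  The identification of \<open>H\<close> with the \<open>I\<close>-invariants of \<open>ind_space\<close>, composed with their inclusion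
  into \<open>ind_space\<close>.
\<close>
definition hecke_incl ::
  "(('g set \<Rightarrow> 'k::field) \<Rightarrow> ('g set \<Rightarrow> 'k)) \<Rightarrow> 'g set \<Rightarrow> ('g set \<Rightarrow> 'k)" where
  "hecke_incl h I = h (char_fun I)"

text \<open>
  The dual of this inclusion; it takes values in \<open>Hom_H(H, H)\<close>, which is \<open>H\<close> under evaluation
  at the identity.
\<close>
definition rho ::
  "'k::field itself \<Rightarrow> ('g, 'm) monoid_scheme \<Rightarrow> 'g set \<Rightarrow>
   (('g set \<Rightarrow> 'k) \<Rightarrow> (('g set \<Rightarrow> 'k) \<Rightarrow> ('g set \<Rightarrow> 'k))) \<Rightarrow>
   ((('g set \<Rightarrow> 'k) \<Rightarrow> ('g set \<Rightarrow> 'k)) \<Rightarrow> (('g set \<Rightarrow> 'k) \<Rightarrow> ('g set \<Rightarrow> 'k)))" where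
  "rho k G I \<phi> = (\<lambda>h\<in>carrier (hecke k G I). \<phi> (hecke_incl h I))"

end

theory Submission
  imports Defs
begin

text \<open>
  Every orbit of \<open>I\<close> on \<open>G/I\<close> is finite, and its size is invertible in \<open>k\<close>: no prime other than
  \<open>p\<close> divides it, because the elements of \<open>I\<close> become unipotent over the residue field, so that their
  \<open>p\<close>-power iterates tend to \<open>1\<close> and act on a finite orbit as elements of \<open>p\<close>-power order.
  Averaging over \<open>I\<close>-orbits is therefore a projection of \<open>X\<close> onto \<open>X^I = H\<close>.  It commutes with
  \<open>H\<close>, so composing with it extends every \<open>H\<close>-linear map \<open>H \<rightarrow> H\<close> to \<open>X\<close>.
\<close>

section \<open>Averaging over orbits\<close>

text \<open>If a prime l divides the size of an orbit, Cauchy's theorem in the finite permutation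
  group that \<open>I\<close> induces on the orbit gives an element of order l; lifting it to
  \<open>I\<close> shows that its order is also a power of p, so l = p. This reduces everything to
  single matrices and single cosets, without a filtration of \<open>I\<close> by normal subgroups.
  The stabilizer of a coset contains all elements of \<open>I\<close> within some distance of 1;
  total boundedness of the ring of integers then makes the orbits finite. One expansion, (1 + Z)^n =
  1 + nZ + Z^2 T, gives both halves of the convergence: over the residue field the term pZ vanishes
  and Z is nilpotent, and over the local field |p| < 1 makes p-th powers a contraction near 1. Orbit
  means stand in for an integral over \<open>I\<close>, so no measure on the group has to be set
  up.\<close>

text \<open>
  The assumption \<open>mult_closed_imp\<close> is needed because \<open>translate\<close> also looks at sets that are not
  contained in the group: a junk product landing in \<open>G\<close> would give translates a junk support.
\<close>
locale hecke_averaging = group G + subgroup I G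
  for K :: "'k::field itself" and G (structure) and I +
  assumes mult_closed_imp: "\<lbrakk>g \<in> carrier G; g \<otimes> x \<in> carrier G\<rbrakk> \<Longrightarrow> x \<in> carrier G"
    and finite_orbit: "c \<in> lcosets I \<Longrightarrow> finite ((\<lambda>i. i <# c) ` I)"
    and card_orbit: "c \<in> lcosets I \<Longrightarrow> of_nat (card ((\<lambda>i. i <# c) ` I)) \<noteq> (0::'k)"
begin

abbreviation V where "V \<equiv> ind_space K G I"
abbreviation delta :: "'a set \<Rightarrow> 'a set \<Rightarrow> 'k" where "delta \<equiv> char_fun"

definition orb where "orb c = (\<lambda>i. i <# c) ` I"

section \<open>Cosets and orbits\<close>

lemma subgroup_I: "subgroup I G" ..

lemma lcoset_carrier: "c \<in> lcosets I \<Longrightarrow> c \<subseteq> carrier G"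
  using lcosets_carrier[OF is_group] by blast

lemma act_act: "\<lbrakk>c \<in> lcosets I; g \<in> carrier G; h \<in> carrier G\<rbrakk> \<Longrightarrow> g <# (h <# c) = (g \<otimes> h) <# c"
  by (simp add: lcos_m_assoc lcoset_carrier)

lemma act_one: "c \<in> lcosets I \<Longrightarrow> \<one> <# c = c"
  by (simp add: lcos_mult_one lcoset_carrier)

lemma lcosetsE:
  assumes "c \<in> lcosets I"
  obtains g where "g \<in> carrier G" "c = g <# I"
  using assms unfolding LCOSETS_def by blast

lemma lcosetsI: "g \<in> carrier G \<Longrightarrow> g <# I \<in> lcosets I"
  unfolding LCOSETS_def by blast

lemma act_lcosets: "\<lbrakk>g \<in> carrier G; c \<in> lcosets I\<rbrakk> \<Longrightarrow> g <# c \<in> lcosets I"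
proof -
  assume g: "g \<in> carrier G" and "c \<in> lcosets I"
  then obtain k where k: "k \<in> carrier G" "c = k <# I" by (auto elim: lcosetsE)
  then have "g <# c = (g \<otimes> k) <# I" using g subset by (simp add: lcos_m_assoc)
  moreover have "g \<otimes> k \<in> carrier G" using g k by simp
  ultimately show ?thesis using lcosetsI by metis
qed

text \<open>For the forward direction, \<open>mult_closed_imp\<close> first puts \<open>c\<close>
  inside the carrier; there acting by \<open>inv g\<close> undoes \<open>g\<close>.\<close>

lemma act_lcosets_iff:
  assumes g: "g \<in> carrier G"
  shows "g <# c \<in> lcosets I \<longleftrightarrow> c \<in> lcosets I"
proof
  assume c: "g <# c \<in> lcosets I"
  have sub: "c \<subseteq> carrier G"
  proof
    fix x assume "x \<in> c"
    then have "g \<otimes> x \<in> g <# c" by (auto simp: l_coset_def)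
    then show "x \<in> carrier G" using lcoset_carrier[OF c] mult_closed_imp[OF g] by blast
  qed
  have "inv g <# (g <# c) \<in> lcosets I" using act_lcosets[OF inv_closed[OF g] c] .
  then show "c \<in> lcosets I" using sub g by (simp add: lcos_m_assoc lcos_mult_one)
qed (simp add: act_lcosets g)

lemma I_lcosets: "I \<in> lcosets I"
  using lcosetsI[of \<one>] by (simp add: lcos_mult_one subset)

lemma act_eq_iff:
  assumes "g \<in> carrier G" "c \<in> lcosets I" "d \<in> lcosets I"
  shows "inv g <# d = c \<longleftrightarrow> d = g <# c"
proof
  assume "inv g <# d = c"
  then have "g <# c = g <# (inv g <# d)" by simp
  then show "d = g <# c" using assms by (simp add: act_act act_one)
next
  assume "d = g <# c"
  then show "inv g <# d = c" using assms by (simp add: act_act act_one)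
qed

lemma orb_self: "c \<in> lcosets I \<Longrightarrow> c \<in> orb c"
  unfolding orb_def using act_one one_closed by force

lemma orb_subset: "c \<in> lcosets I \<Longrightarrow> orb c \<subseteq> lcosets I"
  unfolding orb_def using act_lcosets by auto

lemma orb_act:
  assumes "c \<in> lcosets I" "i \<in> I"
  shows "orb (i <# c) = orb c"
proof
  show "orb (i <# c) \<subseteq> orb c"
    using assms by (auto simp: orb_def act_act)
  show "orb c \<subseteq> orb (i <# c)"
  proof
    fix d assume "d \<in> orb c"
    then obtain j where j: "j \<in> I" "d = j <# c" by (auto simp: orb_def)
    then have "d = (j \<otimes> inv i) <# (i <# c)"
      using assms by (simp add: act_act m_assoc)
    then show "d \<in> orb (i <# c)" using j assms by (auto simp: orb_def)
  qed
qed

lemma orb_eq: "\<lbrakk>c \<in> lcosets I; d \<in> orb c\<rbrakk> \<Longrightarrow> orb d = orb c"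
proof -
  assume c: "c \<in> lcosets I" and "d \<in> orb c"
  then obtain i where "i \<in> I" "d = i <# c" unfolding orb_def by blast
  then show ?thesis using orb_act[OF c] by simp
qed

lemma orb_sym:
  assumes "c \<in> lcosets I" "d \<in> lcosets I"
  shows "c \<in> orb d \<longleftrightarrow> d \<in> orb c"
  using assms orb_eq orb_self by blast

lemma finite_orb: "c \<in> lcosets I \<Longrightarrow> finite (orb c)"
  and card_orb: "c \<in> lcosets I \<Longrightarrow> of_nat (card (orb c)) \<noteq> (0::'k)"
  using finite_orbit card_orbit by (auto simp: orb_def)

section \<open>The space X of finitely supported functions on cosets\<close>

lemma V_zero: "x \<in> V \<Longrightarrow> c \<notin> lcosets I \<Longrightarrow> x c = 0"
  by (auto simp: ind_space_def)

lemma V_finite: "x \<in> V \<Longrightarrow> finite {c. x c \<noteq> 0}"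
  by (auto simp: ind_space_def)

lemma VI: "\<lbrakk>\<And>c. c \<notin> S \<Longrightarrow> x c = 0; finite S; S \<subseteq> lcosets I\<rbrakk> \<Longrightarrow> x \<in> V"
  unfolding ind_space_def by (auto intro: finite_subset[of _ S])

lemma V_0: "(\<lambda>c. 0) \<in> V"
  by (rule VI[of "{}"]) auto

lemma V_add: "\<lbrakk>x \<in> V; y \<in> V\<rbrakk> \<Longrightarrow> (\<lambda>c. x c + y c) \<in> V"
  by (rule VI[of "{c. x c \<noteq> 0} \<union> {c. y c \<noteq> 0}"]) (auto simp: ind_space_def)

lemma V_scale: "x \<in> V \<Longrightarrow> (\<lambda>c. a * x c) \<in> V"
  by (rule VI[of "{c. x c \<noteq> 0}"]) (auto simp: ind_space_def)

lemma V_sum: "\<lbrakk>finite S; \<And>s. s \<in> S \<Longrightarrow> f s \<in> V\<rbrakk> \<Longrightarrow> (\<lambda>c. \<Sum>s\<in>S. f s c) \<in> V"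
  by (induction S rule: finite_induct) (auto intro: V_0 V_add)

lemma V_delta: "c \<in> lcosets I \<Longrightarrow> delta c \<in> V"
  by (rule VI[of "{c}"]) (auto simp: char_fun_def)

lemma V_translate:
  assumes "g \<in> carrier G" "x \<in> V"
  shows "translate G g x \<in> V"
proof (rule VI[of "(\<lambda>c. g <# c) ` {c. x c \<noteq> 0}"])
  have S: "{c. x c \<noteq> 0} \<subseteq> lcosets I" using assms by (auto simp: ind_space_def)
  then show "(\<lambda>c. g <# c) ` {c. x c \<noteq> 0} \<subseteq> lcosets I"
    using act_lcosets assms by blast
  fix c assume c: "c \<notin> (\<lambda>c. g <# c) ` {c. x c \<noteq> 0}"
  show "translate G g x c = 0"
  proof (rule ccontr)
    assume "translate G g x c \<noteq> 0"
    then have *: "x (inv g <# c) \<noteq> 0" by (simp add: translate_def)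
    then have l: "inv g <# c \<in> lcosets I" using assms V_zero by blast
    then have "c \<in> lcosets I" using act_lcosets_iff assms by blast
    then have "c = g <# (inv g <# c)" using assms by (simp add: act_act act_one)
    then show False using c * by blast
  qed
qed (use assms V_finite in auto)

lemma translate_delta:
  assumes "g \<in> carrier G" "c \<in> lcosets I"
  shows "translate G g (delta c) = delta (g <# c)"
proof
  fix d
  show "translate G g (delta c) d = delta (g <# c) d"
  proof (cases "d \<in> lcosets I")
    case True
    then show ?thesis using act_eq_iff assms by (simp add: translate_def char_fun_def)
  next
    case False
    then have "inv g <# d \<noteq> c" "d \<noteq> g <# c" 
      using act_lcosets_iff[of "inv g" d] act_lcosets assms by auto
    then show ?thesis by (simp add: translate_def char_fun_def)
  qed
qed

lemma translate_translate:
  assumes "g \<in> carrier G" "h \<in> carrier G" "x \<in> V"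
  shows "translate G g (translate G h x) = translate G (g \<otimes> h) x"
proof
  fix c
  show "translate G g (translate G h x) c = translate G (g \<otimes> h) x c"
  proof (cases "c \<in> lcosets I")
    case True
    then show ?thesis using assms by (simp add: translate_def act_act inv_mult_group)
  next
    case False
    then show ?thesis using assms by (simp add: translate_def V_zero act_lcosets_iff)
  qed
qed

text \<open>Linearity is separated from equivariance because averaging and single translations,
  which are compared with elements of \<open>H\<close>, need not commute with the whole
  group.\<close>

definition lin where
  "lin L \<longleftrightarrow> (\<forall>x\<in>V. L x \<in> V) \<and>
     (\<forall>x\<in>V. \<forall>y\<in>V. L (\<lambda>c. x c + y c) = (\<lambda>c. L x c + L y c)) \<and>
     (\<forall>a. \<forall>x\<in>V. L (\<lambda>c. a * x c) = (\<lambda>c. a * L x c))"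

lemma lin_add: "\<lbrakk>lin L; x \<in> V; y \<in> V\<rbrakk> \<Longrightarrow> L (\<lambda>c. x c + y c) = (\<lambda>c. L x c + L y c)"
  and lin_scale: "\<lbrakk>lin L; x \<in> V\<rbrakk> \<Longrightarrow> L (\<lambda>c. a * x c) = (\<lambda>c. a * L x c)"
  by (simp_all add: lin_def)

lemma lin_zero: "lin L \<Longrightarrow> L (\<lambda>c. 0) = (\<lambda>c. 0)"
  using lin_scale[OF _ V_0, of L 0] by simp

lemma lin_sum:
  assumes "lin L" "finite S" "\<And>s. s \<in> S \<Longrightarrow> f s \<in> V"
  shows "L (\<lambda>c. \<Sum>s\<in>S. f s c) = (\<lambda>c. \<Sum>s\<in>S. L (f s) c)"
  using assms(2,3)
proof (induction S rule: finite_induct)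
  case empty
  then show ?case using lin_zero[OF assms(1)] by simp
next
  case (insert s S)
  then have "L (\<lambda>c. f s c + (\<Sum>s\<in>S. f s c)) = (\<lambda>c. L (f s) c + L (\<lambda>c. \<Sum>s\<in>S. f s c) c)"
    by (intro lin_add assms(1) V_sum) auto
  then show ?case using insert by simp
qed

lemma V_expand:
  assumes "x \<in> V"
  shows "x = (\<lambda>d. \<Sum>c | x c \<noteq> 0. x c * delta c d)"
proof
  fix d
  have "(\<Sum>c | x c \<noteq> 0. x c * delta c d) = (\<Sum>c | x c \<noteq> 0. if c = d then x c else 0)"
    by (rule sum.cong) (auto simp: char_fun_def)
  then show "x d = (\<Sum>c | x c \<noteq> 0. x c * delta c d)"
    using V_finite[OF assms] by (simp add: sum.delta)
qed

lemma lin_expand: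
  assumes "lin L" "x \<in> V"
  shows "L x = (\<lambda>d. \<Sum>c | x c \<noteq> 0. x c * L (delta c) d)"
proof -
  have mem: "c \<in> lcosets I" if "x c \<noteq> 0" for c using that assms V_zero by blast
  have "L x = L (\<lambda>d. \<Sum>c | x c \<noteq> 0. x c * delta c d)"
    using arg_cong[OF V_expand[OF assms(2)], of L] .
  also have "\<dots> = (\<lambda>d. \<Sum>c | x c \<noteq> 0. L (\<lambda>d. x c * delta c d) d)"
    using assms mem by (intro lin_sum V_scale V_delta) (auto simp: V_finite)
  also have "\<dots> = (\<lambda>d. \<Sum>c | x c \<noteq> 0. x c * L (delta c) d)"
    using lin_scale[OF assms(1) V_delta[OF mem]] by (intro ext sum.cong) simp_all
  finally show ?thesis .
qed

lemma lin_ext: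
  assumes "lin L" "lin M" "\<And>c. c \<in> lcosets I \<Longrightarrow> L (delta c) = M (delta c)" "x \<in> V"
  shows "L x = M x"
proof -
  have "c \<in> lcosets I" if "x c \<noteq> 0" for c using that assms V_zero by blast
  then show ?thesis using assms(3)
    by (simp add: lin_expand[OF assms(1,4)] lin_expand[OF assms(2,4)])
qed

section \<open>The Hecke algebra\<close>

abbreviation H where "H \<equiv> hecke K G I"

lemma carrier_H_iff:
  "h \<in> carrier H \<longleftrightarrow> h \<in> extensional V \<and> lin h \<and>
     (\<forall>g\<in>carrier G. \<forall>x\<in>V. h (translate G g x) = translate G g (h x))"
  by (auto simp: hecke_def ind_end_def lin_def PiE_def)

lemma H_lin: "h \<in> carrier H \<Longrightarrow> lin h"
  and H_translate: "\<lbrakk>h \<in> carrier H; g \<in> carrier G; x \<in> V\<rbrakk> \<Longrightarrow> h (translate G g x) = translate G g (h x)"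
  and H_closed: "\<lbrakk>h \<in> carrier H; x \<in> V\<rbrakk> \<Longrightarrow> h x \<in> V"
  by (auto simp: carrier_H_iff lin_def)

lemma H_mult: "h \<otimes>\<^bsub>H\<^esub> h' = compose V h' h"
  by (simp add: hecke_def)

lemma H_add: "h \<oplus>\<^bsub>H\<^esub> h' = (\<lambda>x\<in>V. \<lambda>c. h x c + h' x c)"
  by (simp add: hecke_def)

lemma H_mult_closed:
  assumes "h \<in> carrier H" "h' \<in> carrier H"
  shows "h \<otimes>\<^bsub>H\<^esub> h' \<in> carrier H"
  using assms by (auto simp: carrier_H_iff H_mult lin_def compose_def V_add V_scale V_translate)

lemma H_add_closed:
  assumes "h \<in> carrier H" "h' \<in> carrier H"
  shows "h \<oplus>\<^bsub>H\<^esub> h' \<in> carrier H"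
  using assms by (auto simp: carrier_H_iff H_add lin_def V_add V_scale V_translate algebra_simps)
   (simp_all add: translate_def)

text \<open>The translates of \<open>delta I\<close> are all the basis functions
  \<open>delta c\<close>, so an equivariant linear map is determined by its value at
  \<open>delta I\<close>; off \<open>V\<close> both maps are undefined by extensionality.\<close>

lemma H_eqI:
  assumes "h \<in> carrier H" "h' \<in> carrier H" "h (delta I) = h' (delta I)"
  shows "h = h'"
proof
  fix x
  have *: "h (delta c) = h' (delta c)" if c: "c \<in> lcosets I" for c
  proof -
    obtain g where g: "g \<in> carrier G" "c = g <# I" using lcosetsE[OF c] by blast
    then have "delta c = translate G g (delta I)" using translate_delta I_lcosets by simp
    then show ?thesis using assms g V_delta[OF I_lcosets] by (simp add: H_translate)
  qed
  show "h x = h' x"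
  proof (cases "x \<in> V")
    case True
    then show ?thesis using lin_ext[of h h'] * assms H_lin by blast
  next
    case False
    then show ?thesis using assms carrier_H_iff by (simp add: extensional_def)
  qed
qed

section \<open>Frobenius reciprocity: the Hecke algebra as the invariants of X\<close>

definition invariant where
  "invariant y \<longleftrightarrow> y \<in> V \<and> (\<forall>i\<in>I. translate G i y = y)"

lemma invariant_H: "\<lbrakk>invariant y; h \<in> carrier H\<rbrakk> \<Longrightarrow> invariant (h y)"
  unfolding invariant_def using H_closed H_translate by (metis subset subsetD)

lemma invariant_delta: "invariant (delta I)"
  unfolding invariant_def using V_delta[OF I_lcosets] translate_delta[OF _ I_lcosets]
  by (simp add: coset_join3 subgroup_I subset[THEN subsetD])

definition rep where "rep c = (SOME g. g \<in> carrier G \<and> c = g <# I)"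

lemma rep_closed: "c \<in> lcosets I \<Longrightarrow> rep c \<in> carrier G"
  and rep_eq: "c \<in> lcosets I \<Longrightarrow> rep c <# I = c"
  unfolding rep_def using someI_ex[of "\<lambda>g. g \<in> carrier G \<and> c = g <# I"] by (metis lcosetsE)+

text \<open>Two representatives of a coset differ by a right factor in \<open>I\<close>, which fixes
  \<open>y\<close>; so the choice made by \<open>rep\<close> is harmless.\<close>

lemma translate_rep:
  assumes "invariant y" "g \<in> carrier G"
  shows "translate G (rep (g <# I)) y = translate G g y"
proof -
  have l: "g <# I \<in> lcosets I" using assms act_lcosets I_lcosets by blast
  define r where "r = rep (g <# I)"
  have r: "r \<in> carrier G" "g <# I = r <# I" using rep_closed[OF l] rep_eq[OF l] by (simp_all add: r_def)
  have "r \<in> g <# I" using lcos_self[OF r(1) subgroup_I] r(2) by simp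
  then have "inv g \<otimes> r \<in> I" by (rule lcos_module_imp[OF is_group assms(2)])
  moreover have "r = g \<otimes> (inv g \<otimes> r)"
    using r(1) assms(2) by (simp flip: m_assoc)
  ultimately obtain i where i: "i \<in> I" "r = g \<otimes> i" by blast
  then have "translate G r y = translate G g (translate G i y)"
    using assms subset by (subst translate_translate) (auto simp: invariant_def)
  then show ?thesis using assms i by (simp add: invariant_def r_def)
qed

text \<open>The linear extension of gI |-> gy. For invariant \<open>y\<close> it is the equivariant
  map sending \<open>delta I\<close> to \<open>y\<close>, so it inverts evaluation at
  \<open>delta I\<close> (see \<open>conv_delta_I\<close> and \<open>conv_unique\<close>) and
  realizes the identification of \<open>H\<close> with the invariants.\<close>

definition conv where
  "conv y = (\<lambda>x\<in>V. \<lambda>d. \<Sum>c | x c \<noteq> 0. x c * translate G (rep c) y d)"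

text \<open>The support of a sum may shrink by cancellation; allowing any finite superset lets
  \<open>conv_lin\<close> compare three sums over one index set.\<close>

lemma conv_sup:
  assumes "x \<in> V" "finite S" "{c. x c \<noteq> 0} \<subseteq> S"
  shows "conv y x = (\<lambda>d. \<Sum>c\<in>S. x c * translate G (rep c) y d)"
  unfolding conv_def using assms by (auto intro!: sum.mono_neutral_left)

lemma conv_delta:
  assumes "invariant y" "g \<in> carrier G"
  shows "conv y (delta (g <# I)) = translate G g y"
proof -
  have "g <# I \<in> lcosets I" using assms act_lcosets I_lcosets by blast
  then have "conv y (delta (g <# I)) =
      (\<lambda>d. \<Sum>c\<in>{g <# I}. delta (g <# I) c * translate G (rep c) y d)"
    by (intro conv_sup V_delta) (auto simp: char_fun_def)
  then show ?thesis using translate_rep[OF assms] by (simp add: char_fun_def)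
qed

lemma conv_lin:
  assumes "invariant y"
  shows "lin (conv y)"
  unfolding lin_def
proof (intro conjI ballI allI)
  have y: "y \<in> V" using assms by (simp add: invariant_def)
  fix x assume x: "x \<in> V"
  have mem: "c \<in> lcosets I" if "x c \<noteq> 0" for c using that x V_zero by blast
  then show "conv y x \<in> V"
    using x y rep_closed V_finite[OF x] unfolding conv_def
    by (auto intro!: V_sum V_scale V_translate)
  fix a 
  have "conv y (\<lambda>c. a * x c) = (\<lambda>d. \<Sum>c | x c \<noteq> 0. (a * x c) * translate G (rep c) y d)"
    using x V_finite[OF x] by (intro conv_sup V_scale) auto
  then show "conv y (\<lambda>c. a * x c) = (\<lambda>c. a * conv y x c)"
    using x by (simp add: conv_def sum_distrib_left mult.assoc)
next
  fix x z assume xz: "x \<in> V" "z \<in> V"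
  let ?S = "{c. x c \<noteq> 0} \<union> {c. z c \<noteq> 0}"
  have f: "finite ?S" using xz V_finite by simp
  have "conv y x = (\<lambda>d. \<Sum>c\<in>?S. x c * translate G (rep c) y d)"
    "conv y z = (\<lambda>d. \<Sum>c\<in>?S. z c * translate G (rep c) y d)"
    "conv y (\<lambda>c. x c + z c) = (\<lambda>d. \<Sum>c\<in>?S. (x c + z c) * translate G (rep c) y d)"
    using f xz by (auto intro!: conv_sup V_add)
  then show "conv y (\<lambda>c. x c + z c) = (\<lambda>c. conv y x c + conv y z c)"
    by (simp add: sum.distrib algebra_simps)
qed

lemma translate_lin:
  assumes "g \<in> carrier G"
  shows "lin (translate G g)"
  unfolding lin_def using V_translate[OF assms] by (simp add: translate_def)

lemma lin_comp: "lin L \<Longrightarrow> lin M \<Longrightarrow> lin (\<lambda>x. L (M x))"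
  by (simp add: lin_def)

lemma conv_H:
  assumes "invariant y"
  shows "conv y \<in> carrier H"
  unfolding carrier_H_iff
proof (intro conjI ballI conv_lin assms)
  show "conv y \<in> extensional V" by (simp add: conv_def)
  fix g x assume g: "g \<in> carrier G" and x: "x \<in> V"
  have lin: "lin (\<lambda>x. conv y (translate G g x))" "lin (\<lambda>x. translate G g (conv y x))"
    using assms g by (simp_all add: lin_comp conv_lin translate_lin)
  have "conv y (translate G g (delta c)) = translate G g (conv y (delta c))" if "c \<in> lcosets I" for c
  proof -
    from that
    obtain k where k: "k \<in> carrier G" "c = k <# I" using lcosetsE by blast
    have y: "y \<in> V" using assms by (simp add: invariant_def)
    have "conv y (translate G g (delta c)) = conv y (delta ((g \<otimes> k) <# I))"
      using g k I_lcosets by (simp add: translate_delta act_lcosets act_act)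
    then show ?thesis
      using assms g k y by (simp add: conv_delta translate_translate)
  qed
  then show "conv y (translate G g x) = translate G g (conv y x)"
    using lin_ext[OF lin _ x] by simp
qed

lemma conv_delta_I: "invariant y \<Longrightarrow> conv y (delta I) = y"
proof -
  assume y: "invariant y"
  then have "translate G \<one> y = y" unfolding invariant_def by simp
  then show ?thesis using conv_delta[OF y, of \<one>] subset by (simp add: lcos_mult_one)
qed

lemma conv_unique: "h \<in> carrier H \<Longrightarrow> conv (h (delta I)) = h"
  using invariant_H[OF invariant_delta] by (simp add: H_eqI conv_H conv_delta_I)

section \<open>The averaging projection onto the invariants\<close>

definition avg :: "('a set \<Rightarrow> 'k) \<Rightarrow> 'a set \<Rightarrow> 'k" where
  "avg x d = (if d \<in> lcosets I then (\<Sum>c\<in>orb d. x c) / of_nat (card (orb d)) else 0)"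

lemma avg_X:
  assumes "x \<in> V"
  shows "avg x \<in> V"
proof (rule VI[of "\<Union> (orb ` {c. x c \<noteq> 0})"])
  have S: "{c. x c \<noteq> 0} \<subseteq> lcosets I" using assms by (auto simp: ind_space_def)
  then show "finite (\<Union> (orb ` {c. x c \<noteq> 0}))" "\<Union> (orb ` {c. x c \<noteq> 0}) \<subseteq> lcosets I"
    using V_finite[OF assms] finite_orb orb_subset by (auto; blast)+
  fix d assume d: "d \<notin> \<Union> (orb ` {c. x c \<noteq> 0})"
  then have "x c = 0" if "c \<in> orb d" "d \<in> lcosets I" for c
    using that orb_sym orb_subset S by blast
  then show "avg x d = 0" by (simp add: avg_def)
qed

lemma avg_lin: "lin avg"
  unfolding lin_def using avg_X
  by (auto simp: avg_def fun_eq_iff sum.distrib add_divide_distrib sum_distrib_left)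

text \<open>Acting by \<open>i\<close> only permutes the terms of each orbit sum.\<close>

lemma avg_translate:
  assumes "i \<in> I" "x \<in> V"
  shows "avg (translate G i x) = avg x"
proof
  fix d
  have "(\<Sum>c\<in>orb d. x (inv i <# c)) = (\<Sum>c\<in>orb d. x c)" if d: "d \<in> lcosets I"
  proof (rule sum.reindex_bij_witness[of _ "\<lambda>c. i <# c" "\<lambda>c. inv i <# c"])
    fix c assume c: "c \<in> orb d"
    then have l: "c \<in> lcosets I" using d orb_subset by blast
    show "inv i <# c \<in> orb d" "i <# c \<in> orb d" 
      using l assms orb_eq[OF d c] orb_act[OF l] orb_self[OF act_lcosets[OF _ l]] m_inv_closed mem_carrier
      by metis+
    show "i <# (inv i <# c) = c" "inv i <# (i <# c) = c"
      using l assms by (simp_all add: act_act act_one)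
  qed auto
  then show "avg (translate G i x) d = avg x d" by (simp add: avg_def translate_def)
qed

lemma avg_invariant:
  assumes "x \<in> V"
  shows "invariant (avg x)"
  unfolding invariant_def
proof (intro conjI ballI avg_X assms ext)
  fix i d assume i: "i \<in> I"
  show "translate G i (avg x) d = avg x d"
    using i orb_act[of d "inv i"] act_lcosets_iff[of "inv i" d] by (auto simp: translate_def avg_def)
qed

text \<open>An invariant function is constant on orbits, so each orbit sum is the size times the
  value. Cancelling the size is where its invertibility in the field enters.\<close>

lemma invariant_avg:
  assumes "invariant y"
  shows "avg y = y"
proof
  fix d
  have y: "y \<in> V" using assms by (simp add: invariant_def)
  have "y c = y d" if "c \<in> orb d" "d \<in> lcosets I" for c
  proof -
    from that obtain i where i: "i \<in> I" "c = i <# d" by (auto simp: orb_def)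
    then have "translate G i y c = y d" using that by (simp add: translate_def act_act act_one)
    then show ?thesis using assms i by (simp add: invariant_def)
  qed
  then have "(\<Sum>c\<in>orb d. y c) = of_nat (card (orb d)) * y d" if "d \<in> lcosets I"
    using that by simp
  then show "avg y d = y d" using V_zero[OF y] card_orb by (auto simp: avg_def)
qed

text \<open>A finite combination of basis functions, so that a linear \<open>h\<close> can be moved
  inside the sum in \<open>avg_H\<close>.\<close>

lemma avg_delta:
  assumes "c \<in> lcosets I"
  shows "avg (delta c) = (\<lambda>d. inverse (of_nat (card (orb c))) * (\<Sum>b\<in>orb c. delta b d))"
proof
  fix d
  have 1: "(\<Sum>b\<in>orb c. delta b d) = (if d \<in> orb c then 1 else 0)"
    using finite_orb[OF assms] by (simp add: char_fun_def)
  show "avg (delta c) d = inverse (of_nat (card (orb c))) * (\<Sum>b\<in>orb c. delta b d)"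
  proof (cases "d \<in> orb c")
    case True
    then have d: "d \<in> lcosets I" "orb d = orb c" using orb_subset[OF assms] orb_eq[OF assms] by auto
    have "(\<Sum>b\<in>orb d. delta c b) = 1"
      using finite_orb[OF assms] orb_self[OF assms] d by (simp add: char_fun_def)
    then show ?thesis using True 1 d by (simp add: avg_def field_simps)
  next
    case False
    then have "(\<Sum>b\<in>orb d. delta c b) = 0" if "d \<in> lcosets I"
      using that assms orb_sym[of c d] by (intro sum.neutral) (auto simp: char_fun_def)
    then show ?thesis using False 1 by (simp add: avg_def)
  qed
qed

text \<open>The images of the orbit of \<open>c\<close> under \<open>h\<close> are translates of each other by \<open>I\<close>, so they have the
  same average, and \<open>h\<close> of the average of \<open>delta c\<close> is invariant.\<close>
lemma avg_H:
  assumes "h \<in> carrier H" "x \<in> V"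
  shows "avg (h x) = h (avg x)"
proof -
  have lin: "lin (\<lambda>x. avg (h x))" "lin (\<lambda>x. h (avg x))"
    using assms by (simp_all add: lin_comp avg_lin H_lin)
  have "avg (h (delta c)) = h (avg (delta c))" if c: "c \<in> lcosets I" for c
  proof -
  let ?n = "of_nat (card (orb c)) :: 'k"
  note dX = V_delta[OF orb_subset[OF c, THEN subsetD]]
  have orb: "avg (h (delta b)) = avg (h (delta c))" if b: "b \<in> orb c" for b
  proof -
    from b obtain i where i: "i \<in> I" "b = i <# c" by (auto simp: orb_def)
    then have "h (delta b) = translate G i (h (delta c))"
      using c assms V_delta by (simp add: H_translate flip: translate_delta)
    then show ?thesis using i c assms by (simp add: avg_translate H_closed V_delta)
  qed
  have "h (avg (delta c)) = avg (h (avg (delta c)))"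
    using assms c by (simp add: invariant_avg invariant_H avg_invariant V_delta)
  also have "\<dots> = (\<lambda>d. inverse ?n * avg (h (\<lambda>d. \<Sum>b\<in>orb c. delta b d)) d)"
    unfolding avg_delta[OF c] by (rule lin_scale[OF lin(1)]) (auto intro!: V_sum finite_orb c dX)
  also have "\<dots> = (\<lambda>d. inverse ?n * (\<Sum>b\<in>orb c. avg (h (delta b)) d))"
    using lin_sum[OF lin(1) finite_orb[OF c] dX] by simp
  also have "\<dots> = avg (h (delta c))"
    using orb card_orb[OF c] by (simp add: fun_eq_iff flip: mult.assoc)
  finally show ?thesis by simp
  qed
  then show ?thesis using lin_ext[OF lin _ assms(2)] by simp
qed

section \<open>Extending linear maps from the Hecke algebra to X\<close>

lemma conv_avg_H: "x \<in> V \<Longrightarrow> conv (avg x) \<in> carrier H"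
  by (simp add: conv_H avg_invariant)

lemma conv_avg_delta_I: "x \<in> V \<Longrightarrow> conv (avg x) (delta I) = avg x"
  by (simp add: conv_delta_I avg_invariant)

text \<open>With \<open>conv_avg_add\<close> this says that the retraction of X onto
  \<open>H\<close> is right \<open>H\<close>-linear. By \<open>H_eqI\<close> only values at
  \<open>delta I\<close> matter, and there the claim is \<open>avg_H\<close>.\<close>

lemma conv_avg_mult:
  assumes "x \<in> V" "h \<in> carrier H"
  shows "conv (avg (h x)) = conv (avg x) \<otimes>\<^bsub>H\<^esub> h"
proof (rule H_eqI)
  show "conv (avg (h x)) \<in> carrier H" "conv (avg x) \<otimes>\<^bsub>H\<^esub> h \<in> carrier H"
    using assms by (simp_all add: conv_avg_H H_closed H_mult_closed)
  show "conv (avg (h x)) (delta I) = (conv (avg x) \<otimes>\<^bsub>H\<^esub> h) (delta I)"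
    using conv_avg_delta_I[OF H_closed[OF assms(2,1)]] assms V_delta[OF I_lcosets]
    by (simp add: conv_avg_delta_I[OF assms(1)] H_mult compose_def avg_H[OF assms(2,1)])
qed

lemma conv_avg_add:
  assumes "x \<in> V" "y \<in> V"
  shows "conv (avg (\<lambda>c. x c + y c)) = conv (avg x) \<oplus>\<^bsub>H\<^esub> conv (avg y)"
proof (rule H_eqI)
  show "conv (avg (\<lambda>c. x c + y c)) \<in> carrier H"
    "conv (avg x) \<oplus>\<^bsub>H\<^esub> conv (avg y) \<in> carrier H"
    using assms by (simp_all add: conv_avg_H V_add H_add_closed)
  show "conv (avg (\<lambda>c. x c + y c)) (delta I) = (conv (avg x) \<oplus>\<^bsub>H\<^esub> conv (avg y)) (delta I)"
    using conv_avg_delta_I[OF V_add[OF assms]] assms V_delta[OF I_lcosets]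
    by (simp add: conv_avg_delta_I H_add lin_add[OF avg_lin])
qed

text \<open>The equality of sets also records that restriction along the inclusion of
  \<open>H\<close> into X produces \<open>H\<close>-linear maps.\<close>

lemma rho_surj: "rho K G I ` ind_dual K G I = hecke_dual K G I"
proof
  show "rho K G I ` ind_dual K G I \<subseteq> hecke_dual K G I"
  proof safe
    fix \<phi> assume \<phi>: "\<phi> \<in> ind_dual K G I"
    have d: "h (delta I) \<in> V" if "h \<in> carrier H" for h
      using that H_closed V_delta[OF I_lcosets] by blast
    have 1: "\<phi> x \<in> carrier H" if "x \<in> V" for x
      using that \<phi> by (auto simp: ind_dual_def right_dual_def)
    have 2: "\<phi> (\<lambda>c. x c + y c) = \<phi> x \<oplus>\<^bsub>H\<^esub> \<phi> y" if "x \<in> V" "y \<in> V" for x y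
      using that \<phi> by (auto simp: ind_dual_def right_dual_def)
    have 3: "\<phi> (h x) = \<phi> x \<otimes>\<^bsub>H\<^esub> h" if "x \<in> V" "h \<in> carrier H" for x h
      using that \<phi> by (auto simp: ind_dual_def right_dual_def)
    have 4: "(h \<oplus>\<^bsub>H\<^esub> h') (delta I) = (\<lambda>c. h (delta I) c + h' (delta I) c)"
      "(h \<otimes>\<^bsub>H\<^esub> h') (delta I) = h' (h (delta I))" for h h'
      using V_delta[OF I_lcosets] by (simp_all add: H_add H_mult compose_def)
    show "rho K G I \<phi> \<in> hecke_dual K G I"
      unfolding hecke_dual_def right_dual_def rho_def hecke_incl_def
      using 1 2 3 d H_add_closed H_mult_closed by (auto simp: 4)
  qed
  show "hecke_dual K G I \<subseteq> rho K G I ` ind_dual K G I"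
  proof
    fix \<psi> assume \<psi>: "\<psi> \<in> hecke_dual K G I"
    \<comment> \<open>\<open>conv (avg x)\<close> is the element of \<open>H\<close> corresponding
      to the average of \<open>x\<close>. For \<open>x = h (delta I)\<close> averaging changes
      nothing and \<open>conv_unique\<close> returns \<open>h\<close>, so the extension restricts to
      the given map.\<close>
    define \<phi> where "\<phi> = (\<lambda>x\<in>V. \<psi> (conv (avg x)))"
    have cH: "conv (avg x) \<in> carrier H" if "x \<in> V" for x
      using that conv_H avg_invariant by blast
    have "\<phi> \<in> ind_dual K G I"
      using \<psi> cH unfolding ind_dual_def hecke_dual_def right_dual_def \<phi>_def
      by (auto simp: conv_avg_mult conv_avg_add V_add H_closed)
    moreover have "rho K G I \<phi> = \<psi>"
    proof
      fix h
      show "rho K G I \<phi> h = \<psi> h"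
      proof (cases "h \<in> carrier H")
        case True
        then have "avg (h (delta I)) = h (delta I)"
          by (simp add: invariant_avg invariant_H[OF invariant_delta])
        then show ?thesis using True V_delta[OF I_lcosets]
          by (simp add: rho_def hecke_incl_def \<phi>_def H_closed conv_unique)
      next
        case False
        then show ?thesis using \<psi>
          by (auto simp: rho_def hecke_dual_def right_dual_def PiE_def extensional_def)
      qed
    qed
    ultimately show "\<psi> \<in> rho K G I ` ind_dual K G I" by blast
  qed
qed

end

section \<open>Orbit sizes\<close>

text \<open>The acting group may be infinite, so the argument runs in its image in the permutations
  of \<open>E\<close>, which is finite. Transitivity makes \<open>card E\<close> divide the order of
  this image. Cauchy gives an element of order \<open>l\<close>, and a preimage of it has a
  \<open>p\<close>-power acting trivially.\<close>

lemma prime_dvd_card_orbit: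
  assumes act: "group_action \<Gamma> E \<phi>" and fin: "finite E" and x: "x \<in> E"
    and orb: "orbit \<Gamma> \<phi> x = E"
    and l: "Factorial_Ring.prime l" "l dvd card E" and p: "Factorial_Ring.prime p"
    and pow: "\<And>g. g \<in> carrier \<Gamma> \<Longrightarrow> \<exists>M. \<forall>y\<in>E. \<phi> (g [^]\<^bsub>\<Gamma>\<^esub> (p ^ M :: nat)) y = y"
  shows "l = p"
proof -
  interpret group_action \<Gamma> E \<phi> by (rule act)
  let ?B = "BijGroup E"
  interpret hom: group_hom \<Gamma> ?B \<phi> by (rule group_hom)
  note B = group_BijGroup[of E]
  let ?S = "\<phi> ` carrier \<Gamma>"
  let ?P = "?B\<lparr>carrier := ?S\<rparr>"
  have S: "subgroup ?S ?B" by (rule hom.img_is_subgroup)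
  interpret P: group ?P by (rule group.subgroup_imp_group[OF B S])
  have "finite (Bij E)"
    by (rule finite_subset[OF _ finite_PiE[OF fin fin]]) (auto simp: Bij_def bij_betw_def PiE_def)
  then have finP: "finite (carrier ?P)"
    using subgroup.subset[OF S] by (auto simp: BijGroup_def intro: finite_subset)
  have actP: "group_action ?P E id"
    using subgroup.subset[OF S] P.group_axioms B
    by (auto simp: group_action_def group_hom_def group_hom_axioms_def hom_def)
  have "orbit ?P id x = E"
    using orb by (auto simp: orbit_def)
  then have "card E * card (stabilizer ?P id x) = order ?P"
    using group_action.orbit_stabilizer_theorem[OF actP x] by simp
  then have "l dvd order ?P" using l(2) by (metis dvd_mult2)
  \<comment> \<open>Exponent 1 turns Sylow's theorem into Cauchy's: a subgroup of order
    \<open>l\<close> is enough.\<close>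
  then obtain m where "order ?P = l ^ 1 * m" by (auto elim: dvdE)
  from sylow_thm[OF l(1) P.group_axioms this finP]
  obtain K where K: "subgroup K ?P" "card K = l ^ 1" by blast
  have "K \<noteq> {\<one>\<^bsub>?P\<^esub>}"
    using K l(1) by (auto dest: prime_gt_1_nat)
  then obtain k where k: "k \<in> K" "k \<noteq> \<one>\<^bsub>?P\<^esub>"
    using subgroup.one_closed[OF K(1)] by blast
  have kP: "k \<in> carrier ?P" using subgroup.mem_carrier[OF K(1) k(1)] .
  interpret K: group "?P\<lparr>carrier := K\<rparr>" by (rule P.subgroup_imp_group[OF K(1)])
  have "k [^]\<^bsub>?P\<lparr>carrier := K\<rparr>\<^esub> order (?P\<lparr>carrier := K\<rparr>) = \<one>\<^bsub>?P\<lparr>carrier := K\<rparr>\<^esub>"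
    using K.pow_order_eq_1 k by simp
  then have kl: "k [^]\<^bsub>?P\<^esub> l = \<one>\<^bsub>?P\<^esub>"
    using K by (simp add: order_def nat_pow_def)
  obtain g where g: "g \<in> carrier \<Gamma>" "k = \<phi> g" using kP by auto
  obtain M where M: "\<forall>y\<in>E. \<phi> (g [^]\<^bsub>\<Gamma>\<^esub> (p ^ M)) y = y" using pow[OF g(1)] by blast
  have "\<phi> (g [^]\<^bsub>\<Gamma>\<^esub> (p ^ M)) \<in> Bij E" using g bij_prop0 by simp
  then have "\<phi> (g [^]\<^bsub>\<Gamma>\<^esub> (p ^ M)) = \<one>\<^bsub>?B\<^esub>"
    using M by (auto simp: Bij_def BijGroup_def extensional_def fun_eq_iff)
  then have "k [^]\<^bsub>?B\<^esub> (p ^ M) = \<one>\<^bsub>?B\<^esub>"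
    using g by (simp add: hom.hom_nat_pow)
  then have kp: "k [^]\<^bsub>?P\<^esub> (p ^ M) = \<one>\<^bsub>?P\<^esub>"
    by (simp add: nat_pow_def)
  have "P.ord k dvd l" "P.ord k dvd p ^ M"
    using P.pow_eq_id[OF kP] kl kp by auto
  moreover have "P.ord k \<noteq> 1" using P.ord_eq_1[OF kP] k by auto
  \<comment> \<open>The order of \<open>k\<close> divides the prime \<open>l\<close> and is not 1,
    hence equals \<open>l\<close>.\<close>
  ultimately have "l dvd p ^ M" using l(1) unfolding prime_nat_iff by blast
  then have "l dvd p" by (rule prime_dvd_power[OF l(1)])
  then show ?thesis by (rule primes_dvd_imp_eq[OF l(1) p])
qed

lemma (in group) prime_dvd_card_coset_orbit:
  fixes I c :: "'a set"
  assumes I: "subgroup I G" and c: "c \<subseteq> carrier G" and fin: "finite ((\<lambda>i. i <# c) ` I)"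
    and l: "Factorial_Ring.prime l" "l dvd card ((\<lambda>i. i <# c) ` I)" and p: "Factorial_Ring.prime p"
    and pow: "\<And>i. i \<in> I \<Longrightarrow>
      \<exists>M. \<forall>y\<in>(\<lambda>i. i <# c) ` I. (i [^] (p ^ M :: nat)) <# y = y"
  shows "l = p"
proof -
  let ?E = "(\<lambda>i. i <# c) ` I"
  \<comment> \<open>The restriction to \<open>?E\<close> is needed because the elements of
    \<open>Bij\<close> are extensional functions.\<close>
  let ?\<phi> = "\<lambda>i. \<lambda>y\<in>?E. i <# y"
  interpret I: subgroup I G by (rule I)
  interpret GI: group "G\<lparr>carrier := I\<rparr>" by (rule subgroup_imp_group[OF I])
  have sub: "y \<subseteq> carrier G" if "y \<in> ?E" for y
    using that c by (auto simp: l_coset_def)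
  have E: "i <# y \<in> ?E" if "i \<in> I" "y \<in> ?E" for i y
  proof -
    from that obtain j where j: "j \<in> I" "y = j <# c" by blast
    have "i <# y = (i \<otimes> j) <# c" using that j c by (simp add: lcos_m_assoc)
    then show ?thesis using that j by blast
  qed
  have inv: "j <# (i <# y) = y" if "j \<otimes> i = \<one>" "i \<in> I" "j \<in> I" "y \<in> ?E" for i j y
    using that sub[OF that(4)] by (simp add: lcos_m_assoc lcos_mult_one)
  have bij: "?\<phi> i \<in> Bij ?E" if i: "i \<in> I" for i
  proof -
    have "bij_betw (\<lambda>y. i <# y) ?E ?E"
    proof (rule bij_betw_byWitness[of _ "\<lambda>y. inv i <# y"])
      show "\<forall>y\<in>?E. inv i <# (i <# y) = y" "\<forall>y\<in>?E. i <# (inv i <# y) = y"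
        using inv i by simp_all
      show "(\<lambda>y. i <# y) ` ?E \<subseteq> ?E" "(\<lambda>y. inv i <# y) ` ?E \<subseteq> ?E"
        using E[OF i] E[OF I.m_inv_closed[OF i]] by (blast intro: image_subsetI)+
    qed
    then show ?thesis by (simp add: Bij_def bij_betw_restrict_eq)
  qed
  have hom: "?\<phi> (i \<otimes> j) = compose ?E (?\<phi> i) (?\<phi> j)" if "i \<in> I" "j \<in> I" for i j
    using that E sub by (auto simp: compose_def fun_eq_iff lcos_m_assoc simp del: image_iff)
  have act: "group_action (G\<lparr>carrier := I\<rparr>) ?E ?\<phi>"
    unfolding group_action_def group_hom_def group_hom_axioms_def
    using GI.group_axioms group_BijGroup[of ?E] bij hom
    by (simp add: hom_def Pi_def) (simp add: BijGroup_def)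
  have x: "c \<in> ?E" using c I.one_closed lcos_mult_one[OF c] by force
  show ?thesis
  proof (rule prime_dvd_card_orbit[OF act fin x _ l p])
    show "orbit (G\<lparr>carrier := I\<rparr>) ?\<phi> c = ?E"
      using x by (auto simp: orbit_def)
    fix i assume "i \<in> carrier (G\<lparr>carrier := I\<rparr>)"
    then have i: "i \<in> I" by simp
    obtain M where "\<forall>y\<in>?E. (i [^] (p ^ M)) <# y = y" using pow[OF i] by blast
    then show "\<exists>M. \<forall>y\<in>?E. ?\<phi> (i [^]\<^bsub>G\<lparr>carrier := I\<rparr>\<^esub> (p ^ M)) y = y"
      by (intro exI[of _ M]) (simp add: nat_pow_def)
  qed
qed

section \<open>Powers of matrices\<close>

text \<open>Iterated left multiplication, in the shape used by \<open>unipotent\<close>. It must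
  cover singular matrices such as the nilpotent \<open>A - mat 1\<close>; \<open>nat_pow_GL\<close>
  links it to powers in the group.\<close>

definition mpow :: "'a::comm_ring_1^'n::finite^'n \<Rightarrow> nat \<Rightarrow> 'a^'n^'n" where
  "mpow A n = ((**) A ^^ n) (mat 1)"

lemma mpow_0 [simp]: "mpow A 0 = mat 1"
  and mpow_Suc [simp]: "mpow A (Suc n) = A ** mpow A n"
  by (simp_all add: mpow_def)

lemma mpow_add: "mpow A (m + n) = mpow A m ** mpow A n"
  by (induction m) (simp_all add: matrix_mul_assoc)

lemma mpow_mult: "mpow A (m * n) = mpow (mpow A m) n"
  by (induction n) (simp_all add: mpow_add)

lemma mpow_commute: "A ** mpow A n = mpow A n ** A"
proof (induction n)
  case (Suc n)
  then have "A ** (A ** mpow A n) = A ** (mpow A n ** A)" by simp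
  then show ?case by (simp add: matrix_mul_assoc)
qed simp

lemma nat_pow_GL: "A [^]\<^bsub>GL\<lparr>carrier := S\<rparr>\<^esub> n = mpow A (n::nat)"
  by (induction n) (simp_all add: nat_pow_def GL_def mpow_commute)

lemma mat_add: "mat (a + b) = mat a + (mat b :: 'a::comm_ring_1^'n::finite^'n)"
  by (vector mat_def)

lemma matrix_add_rdistrib: "(A + B) ** C = A ** C + B ** C"
  by (vector matrix_matrix_mult_def sum.distrib[symmetric] field_simps)

lemma matrix_diff_ldistrib: "A ** (B - C) = A ** B - A ** C" for A :: "'a::comm_ring_1^'n^'m"
  by (vector matrix_matrix_mult_def sum_subtractf[symmetric] algebra_simps)

lemma matrix_diff_rdistrib: "(A - B) ** C = A ** C - B ** C" for A :: "'a::comm_ring_1^'n^'m"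
  by (vector matrix_matrix_mult_def sum_subtractf[symmetric] algebra_simps)

text \<open>The binomial theorem cut off after the linear term. \<open>R\<close> keeps control of
  the remainder \<open>T\<close>: it is taken to be the double commutant of \<open>Z\<close> in
  \<open>unipotent_power\<close> and the matrices with integral entries in
  \<open>mpow_contract\<close>.\<close>

lemma mpow_expand:
  fixes A :: "'a::comm_ring_1^'n::finite^'n"
  defines "Z \<equiv> A - mat 1"
  assumes R: "0 \<in> R" "mat 1 \<in> R" "Z \<in> R"
    and add: "\<And>M M'. \<lbrakk>M \<in> R; M' \<in> R\<rbrakk> \<Longrightarrow> M + M' \<in> R"
    and mul: "\<And>M M'. \<lbrakk>M \<in> R; M' \<in> R\<rbrakk> \<Longrightarrow> M ** M' \<in> R"
  shows "\<exists>T\<in>R. mpow A n = mat 1 + Z ** (mat (of_nat n) + Z ** T)"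
proof (induction n)
  case 0
  then show ?case using R by (intro bexI[of _ 0]) simp_all
next
  case (Suc n)
  then obtain T where T: "T \<in> R" "mpow A n = mat 1 + Z ** (mat (of_nat n) + Z ** T)" by blast
  have nat: "mat (of_nat k) \<in> R" for k
    by (induction k) (auto simp: mat_add R add)
  have A: "A = mat 1 + Z" by (simp add: Z_def)
  show ?case
  proof (rule bexI)
    \<comment> \<open>The new remainder is read off from the product (1 + Z)(1 + Z(n + ZT)).\<close>
    show "T + mat (of_nat n) + Z ** T \<in> R" using T nat R by (intro add mul)
    show "mpow A (Suc n) = mat 1 + Z ** (mat (of_nat (Suc n)) + Z ** (T + mat (of_nat n) + Z ** T))"
      unfolding mpow_Suc T(2) of_nat_Suc mat_add
      by (subst A) (simp add: matrix_add_ldistrib matrix_add_rdistrib matrix_mul_assoc algebra_simps)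
  qed
qed

text \<open>If A = 1 + Y, the linear term pY of A^p vanishes and Y^2 divides A^p - 1. Iterating,
  Z^(2^a) divides A^(p^a) - 1, provided the cofactors can be moved past powers of Z; this is why
  they are kept in a commutative ring.\<close>

lemma unipotent_power:
  fixes A :: "'a::field^'n::finite^'n"
  assumes "unipotent A" and p: "of_nat p = (0::'a)"
  shows "\<exists>a. mpow A (p ^ a) = mat 1"
proof -
  define Z where "Z = A - mat 1"
  \<comment> \<open>the double commutant of \<open>Z\<close>, a commutative ring containing \<open>Z\<close>\<close>
  define R where "R = {M. \<forall>N. N ** Z = Z ** N \<longrightarrow> M ** N = N ** M}"
  have Z: "Z \<in> R" by (auto simp: R_def)
  have R: "0 \<in> R" "mat 1 \<in> R" by (auto simp: R_def)
  have add: "M + M' \<in> R" if "M \<in> R" "M' \<in> R" for M M'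
    using that by (simp add: R_def matrix_add_ldistrib matrix_add_rdistrib)
  have mul: "M ** M' \<in> R" if "M \<in> R" "M' \<in> R" for M M'
    unfolding R_def
  proof safe
    fix N assume N: "N ** Z = Z ** N"
    then have c: "M ** N = N ** M" "M' ** N = N ** M'" using that by (auto simp: R_def)
    have "M ** M' ** N = M ** (M' ** N)" by (simp add: matrix_mul_assoc)
    also have "\<dots> = M ** N ** M'" by (simp add: c(2) matrix_mul_assoc)
    finally show "M ** M' ** N = N ** (M ** M')" by (simp add: c(1) matrix_mul_assoc)
  qed
  have comm: "M ** M' = M' ** M" if "M \<in> R" "M' \<in> R" for M M'
  proof -
    have "M' ** Z = Z ** M'" using that(2) by (auto simp: R_def)
    then show ?thesis using that(1) by (auto simp: R_def)
  qed
  have Zk: "mpow Z k \<in> R" for k by (induction k) (simp_all add: R Z mul)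
  have "\<exists>T\<in>R. mpow A (p ^ a) = mat 1 + mpow Z (2 ^ a) ** T" for a
  proof (induction a)
    case 0
    show ?case using R by (intro bexI[of _ "mat 1"]) (simp_all add: Z_def)
  next
    case (Suc a)
    then obtain T where T: "T \<in> R" "mpow A (p ^ a) = mat 1 + mpow Z (2 ^ a) ** T" by blast
    define k where "k = (2::nat) ^ a"
    have Y: "mpow A (p ^ a) - mat 1 = mpow Z k ** T" by (simp add: T k_def)
    have YR: "mpow Z k ** T \<in> R" using mul Zk T by blast
    from mpow_expand[of R "mpow A (p ^ a)" p, unfolded Y, OF R YR add mul]
    obtain T' where T': "T' \<in> R" 
      "mpow (mpow A (p ^ a)) p = mat 1 + mpow Z k ** T ** (mpow Z k ** T ** T')"
      using p by auto
    have "mpow Z k ** T ** (mpow Z k ** T ** T') = mpow Z k ** (T ** mpow Z k) ** (T ** T')"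
      by (simp add: matrix_mul_assoc)
    also have "\<dots> = mpow Z (k + k) ** (T ** T ** T')"
      using comm[OF T(1) Zk[of k]] by (simp add: mpow_add matrix_mul_assoc)
    finally have "mpow A (p ^ Suc a) = mat 1 + mpow Z (2 ^ Suc a) ** (T ** T ** T')"
      using T'(2) mpow_mult[of A "p ^ a" p] by (simp add: k_def mult.commute mult_2)
    then show ?case using T T' mul by blast
  qed
  moreover obtain m where m: "mpow Z m = 0"
    using assms(1) by (auto simp: unipotent_def mpow_def Z_def)
  \<comment> \<open>Since m <= 2^m, the nilpotency exponent \<open>m\<close> itself can be taken as
    \<open>a\<close>.\<close>
  have "mpow Z (2 ^ m) = mpow Z m ** mpow Z (2 ^ m - m)"
    by (simp flip: mpow_add)
  ultimately show ?thesis by (metis m add.right_neutral times0_left)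
qed

section \<open>Base change of matrices and rational points\<close>

lemma map_matrix_mult:
  fixes f :: "'a::comm_ring_1 \<Rightarrow> 'b::comm_ring_1" and A B :: "'a^'n::finite^'n"
  assumes "\<And>x y. f (x + y) = f x + f y" "\<And>x y. f (x * y) = f x * f y" "f 0 = 0"
  shows "map_matrix f (A ** B) = map_matrix f A ** map_matrix f B"
proof -
  have "f (sum g S) = (\<Sum>k\<in>S. f (g k))" if "finite S" for g and S :: "'n set"
    using that by (induction S rule: finite_induct) (auto simp: assms)
  from this[OF finite] show ?thesis by (simp add: vec_eq_iff matrix_matrix_mult_def assms)
qed

lemma map_matrix_to_ac_mult:
  "map_matrix to_ac (A ** B) = map_matrix to_ac A ** map_matrix to_ac B" for A B :: "'a::field^'n::finite^'n"
  by (rule map_matrix_mult) auto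

lemma map_matrix_to_ac_1 [simp]: "map_matrix to_ac (mat 1) = mat 1"
  by (simp add: vec_eq_iff mat_def)

lemma map_matrix_to_ac_eq_iff: "map_matrix to_ac A = map_matrix to_ac B \<longleftrightarrow> A = B"
  by (simp add: vec_eq_iff)

lemma mpow_map_matrix_to_ac: "map_matrix to_ac (mpow A n) = mpow (map_matrix to_ac A) n"
  by (induction n) (simp_all add: map_matrix_to_ac_mult)

lemma det_map_matrix_to_ac: "det (map_matrix to_ac A) = to_ac (det A)"
  by (simp add: det_def to_ac_sum to_ac_prod)

lemma group_GL: "group (GL :: ('a::field^'n::finite^'n) monoid)"
proof (rule groupI)
  fix A :: "'a^'n^'n" assume "A \<in> carrier GL"
  then show "\<exists>B\<in>carrier GL. B \<otimes>\<^bsub>GL\<^esub> A = \<one>\<^bsub>GL\<^esub>"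
    unfolding GL_def invertible_def by auto
  fix B :: "'a^'n^'n" assume "B \<in> carrier GL"
  then show "A \<otimes>\<^bsub>GL\<^esub> B \<in> carrier GL"
    using \<open>A \<in> carrier GL\<close> by (simp add: GL_def invertible_mult)
next
  show "\<one>\<^bsub>GL\<^esub> \<in> carrier (GL :: ('a^'n^'n) monoid)"
    by (auto simp: GL_def invertible_def intro: exI[of _ "mat 1"])
qed (simp_all add: GL_def matrix_mul_assoc)

lemma inv_GL: "A ** B = mat 1 \<Longrightarrow> inv\<^bsub>GL\<^esub> A = B" for A B :: "'a::field^'n::finite^'n"
proof (rule group.inv_equality[OF group_GL])
  assume "A ** B = mat 1"
  then have "B ** A = mat 1" "A ** B = mat 1" using matrix_left_right_inverse by auto
  then show "B \<otimes>\<^bsub>GL\<^esub> A = \<one>\<^bsub>GL\<^esub>" "A \<in> carrier GL" "B \<in> carrier GL"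
    by (auto simp: GL_def invertible_def)
qed

text \<open>The point is closure under inverses: a matrix over the small field that is invertible
  over the closure has non-zero determinant already below, and its inverse there maps to the inverse
  in \<open>S\<close>.\<close>

lemma subgroup_rational_points:
  assumes S: "subgroup S GL"
  shows "subgroup (rational_points to_ac S) GL"
proof (rule group.subgroupI[OF group_GL])
  interpret S: subgroup S GL by (rule S)
  have inv: "\<exists>B. A ** B = mat 1 \<and> B \<in> rational_points to_ac S" if "A \<in> rational_points to_ac S" for A
  proof -
    have "map_matrix to_ac A \<in> S" using that by (simp add: rational_points_def)
    then have "invertible (map_matrix to_ac A)" using S.subset by (auto simp: GL_def)
    then have "invertible A" by (simp add: invertible_det_nz det_map_matrix_to_ac)
    then obtain B where B: "A ** B = mat 1" by (auto simp: invertible_def)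
    then have "map_matrix to_ac A ** map_matrix to_ac B = mat 1"
      by (simp flip: map_matrix_to_ac_mult)
    then have "map_matrix to_ac B \<in> S"
      using inv_GL S.m_inv_closed \<open>map_matrix to_ac A \<in> S\<close> by metis
    then show ?thesis using B by (auto simp: rational_points_def)
  qed
  show "rational_points to_ac S \<subseteq> carrier GL"
    using inv by (auto simp: GL_def invertible_def matrix_left_right_inverse)
  have "mat 1 \<in> S" using S.one_closed by (simp add: GL_def)
  then show "rational_points to_ac S \<noteq> {}"
    by (auto simp: rational_points_def intro!: exI[of _ "mat 1"])
  fix A assume A: "A \<in> rational_points to_ac S"
  show "inv\<^bsub>GL\<^esub> A \<in> rational_points to_ac S" using inv[OF A] inv_GL by metis
  fix B assume "B \<in> rational_points to_ac S"
  then show "A \<otimes>\<^bsub>GL\<^esub> B \<in> rational_points to_ac S"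
    using A S.m_closed by (auto simp: rational_points_def map_matrix_to_ac_mult GL_def)
qed

section \<open>Matrices over a local field\<close>

locale local_valuation =
  fixes v :: "'f::field \<Rightarrow> real"
  assumes local: "local_field v"
begin

section \<open>Ultrametric estimates\<close>

lemma v_nonneg [simp]: "0 \<le> v x"
  and v_eq_0 [simp]: "v x = 0 \<longleftrightarrow> x = 0"
  and v_mult: "v (x * y) = v x * v y"
  and v_add: "v (x + y) \<le> max (v x) (v y)"
  using local by (auto simp: local_field_def)

lemma v_0 [simp]: "v 0 = 0"
  by simp

lemma v_1 [simp]: "v 1 = 1"
  using v_mult[of 1 1] by simp

lemma v_minus [simp]: "v (- x) = v x"
proof -
  have "v (-1) * v (-1) = 1" using v_mult[of "-1" "-1"] by simp
  then have "v (-1) = 1" using v_nonneg[of "-1"] square_eq_1_iff[of "v (-1)"] by linarith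
  then show ?thesis using v_mult[of "-1" x] by simp
qed

lemma v_diff: "v (x - y) \<le> max (v x) (v y)"
  using v_add[of x "- y"] by simp

lemma v_diff_commute: "v (x - y) = v (y - x)"
  using v_minus[of "x - y"] by simp

lemma v_power: "v (x ^ n) = v x ^ n"
  by (induction n) (simp_all add: v_mult)

lemma v_sum: "\<lbrakk>finite S; \<And>s. s \<in> S \<Longrightarrow> v (f s) \<le> r; 0 \<le> r\<rbrakk> \<Longrightarrow> v (sum f S) \<le> r"
proof (induction S rule: finite_induct)
  case (insert s S)
  then show ?case using v_add[of "f s" "sum f S"] by (auto intro: order_trans)
qed simp

lemma v_of_nat: "v (of_nat n) \<le> 1"
proof (induction n)
  case (Suc n)
  then show ?case using v_add[of 1 "of_nat n"] by simp
qed simp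

text \<open>A bound on the sup norm, which for an ultrametric absolute value is submultiplicative
  with no factor depending on the size of the matrix.\<close>

definition mle :: "real \<Rightarrow> 'f^'n::finite^'n \<Rightarrow> bool" where
  "mle r A \<longleftrightarrow> (\<forall>i j. v (A $ i $ j) \<le> r)"

lemma mle_mono: "mle r A \<Longrightarrow> r \<le> s \<Longrightarrow> mle s A"
  unfolding mle_def using order_trans by blast

lemma mle_mult: "\<lbrakk>mle r A; mle s B; 0 \<le> r; 0 \<le> s\<rbrakk> \<Longrightarrow> mle (r * s) (A ** B)"
  unfolding mle_def matrix_matrix_mult_def by (auto intro!: v_sum mult_mono simp: v_mult)

lemma mle_add: "\<lbrakk>mle r A; mle r B\<rbrakk> \<Longrightarrow> mle r (A + B)"
  unfolding mle_def using order_trans[OF v_add] by auto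

lemma mle_minus: "mle r (A - B) = mle r (B - A)"
  unfolding mle_def by (simp add: v_diff_commute)

lemma mle_mat: "v c \<le> r \<Longrightarrow> mle r (mat c)"
  unfolding mle_def mat_def using order_trans[OF v_nonneg[of c]] by simp

lemma mle_0: "0 \<le> r \<Longrightarrow> mle r 0"
  unfolding mle_def by simp

lemma mle_mult_1: "\<lbrakk>mle 1 A; mle r B; 0 \<le> r\<rbrakk> \<Longrightarrow> mle r (A ** B)"
  using mle_mult[of 1 A r B] by simp

lemma mle_mult_1': "\<lbrakk>mle r A; mle 1 B; 0 \<le> r\<rbrakk> \<Longrightarrow> mle r (A ** B)"
  using mle_mult[of r A 1 B] by simp

text \<open>Turns strict bounds on all entries into a single r < 1, as \<open>mpow_converges\<close>
  requires.\<close>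

lemma mle_attained:
  fixes A :: "'f^'n::finite^'n"
  shows "\<exists>i j. mle (v (A $ i $ j)) A"
proof -
  let ?V = "(\<lambda>(i,j). v (A $ i $ j)) ` UNIV"
  have "Max ?V \<in> ?V" by (rule Max_in) auto
  then obtain i j where "Max ?V = v (A $ i $ j)" by (elim imageE) (simp add: case_prod_beta)
  moreover have "mle (Max ?V) A"
    unfolding mle_def by (auto intro!: Max_ge)
  ultimately show ?thesis by metis
qed

lemma mle_mpow: "mle 1 A \<Longrightarrow> mle 1 (mpow A n)"
  by (induction n) (auto intro: mle_mult_1 mle_mat)

text \<open>In the correction Z(n + ZT) the first factor is bounded by \<open>r\<close> and, as
  \<open>T\<close> is integral, the second by max(|n|, r).\<close>

lemma mpow_contract:
  assumes r: "mle r (A - mat 1)" "0 \<le> r" "r \<le> 1"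
  shows "mle (r * max (v (of_nat n)) r) (mpow A n - mat 1)"
proof -
  let ?Z = "A - mat 1" and ?m = "max (v (of_nat n)) r"
  let ?R = "{M. mle 1 M}"
  have Z1: "mle 1 ?Z" using mle_mono[OF r(1) r(3)] .
  have "\<exists>T\<in>?R. mpow A n = mat 1 + ?Z ** (mat (of_nat n) + ?Z ** T)"
    by (rule mpow_expand) (auto simp: mle_0 mle_mat Z1 mle_add mle_mult_1)
  then obtain T where T: "mle 1 T" "mpow A n = mat 1 + ?Z ** (mat (of_nat n) + ?Z ** T)" by auto
  have "mle ?m (mat (of_nat n))" by (rule mle_mat) simp
  moreover have "mle ?m (?Z ** T)"
    using mle_mult_1'[OF r(1) T(1) r(2)] by (rule mle_mono) simp
  ultimately have "mle ?m (mat (of_nat n) + ?Z ** T)" by (rule mle_add)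
  then show ?thesis using mle_mult[OF r(1) _ r(2)] r(2) unfolding T(2) by simp
qed

text \<open>Each p-th power shrinks the distance to 1 by a factor of at most q = max(|p|, r) < 1.
  The distance never exceeds \<open>r\<close> again, so the factor of the first step serves for
  all.\<close>

lemma mpow_converges:
  assumes A: "mle r (A - mat 1)" "0 \<le> r" "r < 1" and p: "v (of_nat p) < 1" and e: "0 < e"
  shows "\<exists>M. mle e (mpow A (p ^ M) - mat 1)"
proof -
  define q where "q = max (v (of_nat p)) r"
  have q: "0 \<le> q" "q < 1" using A p by (auto simp: q_def)
  have *: "mle (r * q ^ M) (mpow A (p ^ M) - mat 1)" for M
  proof (induction M)
    case 0
    then show ?case using A by simp
  next
    case (Suc M)
    let ?s = "r * q ^ M"
    have s: "0 \<le> ?s" "?s \<le> r" "?s \<le> 1"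
      using q A by (auto simp: mult_left_le power_le_one intro: order_trans[OF mult_left_le])
    have "mle (?s * max (v (of_nat p)) ?s) (mpow (mpow A (p ^ M)) p - mat 1)"
      by (rule mpow_contract[OF Suc s(1,3)])
    moreover have "?s * max (v (of_nat p)) ?s \<le> r * q ^ Suc M"
      using s mult_left_mono[of "max (v (of_nat p)) ?s" q ?s] by (auto simp: q_def mult_ac)
    ultimately show ?case
      using mle_mono mpow_mult[of A "p ^ M" p] by (simp add: mult.commute)
  qed
  obtain M where "q ^ M < e" using real_arch_pow_inv[OF e q(2)] by blast
  then have "r * q ^ M \<le> e" using A q mult_right_mono[of r 1 "q ^ M"] by simp
  then show ?thesis using * mle_mono by blast
qed

text \<open>A compact neighbourhood of \<open>0\<close> contains a multiple \<open>c O\<close> of the ring of integers.\<close>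
lemma finite_net:
  assumes e: "0 < e"
  shows "\<exists>T. finite T \<and> (\<forall>x. v x \<le> 1 \<longrightarrow> (\<exists>t\<in>T. v (x - t) < e))"
proof -
  interpret M: Metric_space UNIV "\<lambda>x y. v (x - y)"
  proof
    fix x y z :: 'f
    show "v (x - y) = v (y - x)" by (rule v_diff_commute)
    have "v (x - z) \<le> max (v (x - y)) (v (y - z))" using v_add[of "x - y" "y - z"] by simp
    also have "\<dots> \<le> v (x - y) + v (y - z)" by simp
    finally show "v (x - z) \<le> v (x - y) + v (y - z)" .
  qed auto
  have "locally_compact_space M.mtopology" using local by (simp add: local_field_def)
  then obtain U K where UK: "openin M.mtopology U" "compactin M.mtopology K" "0 \<in> U" "U \<subseteq> K"
    unfolding locally_compact_space_def M.topspace_mtopology by blast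
  obtain d where d: "d > 0" "M.mball 0 d \<subseteq> U"
    using UK M.openin_mtopology by blast
  obtain x where x: "x \<noteq> 0" "v x \<noteq> 1" using local by (auto simp: local_field_def)
  \<comment> \<open>By nontriviality, \<open>x\<close> or its inverse has absolute value below 1;
    powers then give non-zero elements as small as desired.\<close>
  obtain y where y: "y \<noteq> 0" "v y < 1"
  proof (cases "v x < 1")
    case False
    have "v x * v (inverse x) = 1" using x by (simp flip: v_mult)
    then have "v (inverse x) = inverse (v x)" using x by (simp add: field_simps)
    then have "v (inverse x) < 1" using x False by (simp add: inverse_less_1_iff)
    then show ?thesis using that[of "inverse x"] x by simp
  qed (use that x in auto)
  obtain n where "v y ^ n < d" using real_arch_pow_inv[OF d(1) y(2)] by blast
  then have "y ^ n \<noteq> 0" "v (y ^ n) < d" using y by (simp_all add: v_power)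
  then obtain c where c: "c \<noteq> 0" "v c < d" by blast
  have vc: "0 < v c" using c v_nonneg[of c] v_eq_0[of c] by (simp add: less_le)
  \<comment> \<open>The radius is scaled by \<open>v c\<close> because dividing by \<open>c\<close>
    carries a net of c O to a net of O with radius \<open>e\<close>.\<close>
  have "M.mtotally_bounded K" using M.compactin_imp_mtotally_bounded UK by blast
  then obtain S where S: "finite S" "K \<subseteq> (\<Union>x\<in>S. M.mball x (e * v c))"
    unfolding M.mtotally_bounded_def using mult_pos_pos[OF e vc] by blast
  show ?thesis
  proof (intro exI[of _ "(\<lambda>s. s / c) ` S"] conjI allI impI)
    fix x assume "v x \<le> 1"
    then have "v (c * x) \<le> v c" using vc by (simp add: v_mult mult_left_le)
    then have "v (c * x) < d" using c by simp
    then have "c * x \<in> K" using d UK by (auto simp: M.mball_def)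
    then obtain s where s: "s \<in> S" "v (s - c * x) < e * v c" using S by auto
    have "s - c * x = c * (s / c - x)" using c by (simp add: field_simps)
    then have "v (s - c * x) = v c * v (x - s / c)" by (simp add: v_mult v_diff_commute)
    then have "v (x - s / c) < e" using s vc by (simp add: mult.commute)
    then show "\<exists>t\<in>(\<lambda>s. s / c) ` S. v (x - t) < e" using s by blast
  qed (use S in auto)
qed

end

section \<open>The pro-p-Iwahori subgroup\<close>

locale iwahori = local_valuation v
  for v :: "'f::field \<Rightarrow> real" +
  fixes red :: "'f \<Rightarrow> 'q::{field,finite}"
    and G :: "('f alg_closure^'n::finite^'n) set"
    and N :: "('q alg_closure^'n^'n) set"
  assumes red: "residue_map v red"
    and G: "subgroup G GL"
    and N: "subgroup N GL"
    and unip: "A \<in> N \<Longrightarrow> unipotent A"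
begin

section \<open>Reduction to the residue field\<close>

lemma red_add: "\<lbrakk>v x \<le> 1; v y \<le> 1\<rbrakk> \<Longrightarrow> red (x + y) = red x + red y"
  and red_mult: "\<lbrakk>v x \<le> 1; v y \<le> 1\<rbrakk> \<Longrightarrow> red (x * y) = red x * red y"
  and red_1: "red 1 = 1"
  and red_eq_0: "v x \<le> 1 \<Longrightarrow> red x = 0 \<longleftrightarrow> v x < 1"
  using red by (auto simp: residue_map_def integers_def)

lemma red_0: "red 0 = 0"
  using red_eq_0[of 0] by simp

lemma red_of_nat: "red (of_nat n) = of_nat n"
proof (induction n)
  case (Suc n)
  then show ?case using red_add[OF _ v_of_nat[of n], of 1] red_1 by simp
qed (simp add: red_0)

text \<open>Supplies the contraction factor in both cases: in equal characteristic this value is 0,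
  in mixed characteristic it lies strictly between 0 and 1.\<close>

lemma v_CHAR: "v (of_nat CHAR('q)) < 1"
  using red_eq_0[OF v_of_nat] red_of_nat[of "CHAR('q)"] by simp

lemma red_sum: "\<lbrakk>finite S; \<And>s. s \<in> S \<Longrightarrow> v (f s) \<le> 1\<rbrakk> \<Longrightarrow> red (sum f S) = (\<Sum>s\<in>S. red (f s))"
  by (induction S rule: finite_induct) (simp_all add: red_0 red_add v_sum)

text \<open>\<open>red\<close> is a homomorphism only on the ring of integers, so
  \<open>map_matrix_mult\<close> does not apply and the entries have to be bounded.\<close>

lemma map_red_mult:
  assumes "mle 1 A" "mle 1 B"
  shows "map_matrix red (A ** B) = map_matrix red A ** map_matrix red B"
  using assms
  by (simp add: vec_eq_iff matrix_matrix_mult_def mle_def red_sum red_mult v_mult mult_le_one)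

lemma map_red_1: "map_matrix red (mat 1) = mat 1"
  by (simp add: vec_eq_iff mat_def red_0 red_1)

lemma map_red_mpow: "mle 1 A \<Longrightarrow> map_matrix red (mpow A n) = mpow (map_matrix red A) n"
  by (induction n) (simp_all add: map_red_1 map_red_mult mle_mpow)

text \<open>The bridge between the two stages of the power argument: trivial reduction means
  distance less than 1 from the identity.\<close>

lemma map_red_eq_1:
  assumes "mle 1 A"
  shows "map_matrix red A = mat 1 \<longleftrightarrow> (\<forall>i j. v ((A - mat 1) $ i $ j) < 1)"
proof -
  have "red (A $ i $ j) = mat 1 $ i $ j \<longleftrightarrow> v ((A - mat 1) $ i $ j) < 1" for i j
  proof -
    let ?e = "mat 1 $ i $ j :: 'f"
    have e: "v ?e \<le> 1" "red ?e = mat 1 $ i $ j" by (auto simp: mat_def red_0 red_1)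
    have "v (A $ i $ j - ?e) \<le> 1" 
      using v_diff[of "A $ i $ j" ?e] assms e by (auto simp: mle_def intro: order_trans)
    then show ?thesis using red_add[of "A $ i $ j - ?e" ?e] red_eq_0 e by auto
  qed
  then show ?thesis by (simp add: vec_eq_iff)
qed

section \<open>The rational points and the pro-p-Iwahori subgroup\<close>

abbreviation Q where "Q \<equiv> rational_points to_ac G"
abbreviation \<Gamma> where "\<Gamma> \<equiv> GL\<lparr>carrier := Q\<rparr>"
abbreviation J where "J \<equiv> pro_p_iwahori v red G N"

lemma Q: "subgroup Q GL"
  by (rule subgroup_rational_points[OF G])

lemma Q_mult: "\<lbrakk>A \<in> Q; B \<in> Q\<rbrakk> \<Longrightarrow> A ** B \<in> Q"
  using subgroup.m_closed[OF Q] by (simp add: GL_def)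

lemma Q_inv: "\<lbrakk>A \<in> Q; A ** B = mat 1\<rbrakk> \<Longrightarrow> B \<in> Q"
  using subgroup.m_inv_closed[OF Q] inv_GL by metis

lemma Q_invE:
  assumes "A \<in> Q"
  obtains B where "B \<in> Q" "A ** B = mat 1" "B ** A = mat 1"
proof -
  have "invertible A" using subgroup.subset[OF Q] assms by (auto simp: GL_def)
  then show ?thesis using that Q_inv[OF assms] by (auto simp: invertible_def)
qed

lemma group_\<Gamma>: "group \<Gamma>"
  by (rule group.subgroup_imp_group[OF group_GL Q])

lemma J_iff: "A \<in> J \<longleftrightarrow> A \<in> Q \<and> mle 1 A \<and> (\<exists>A'. mle 1 A' \<and> A ** A' = mat 1 \<and> A' ** A = mat 1)
    \<and> map_matrix to_ac (map_matrix red A) \<in> N"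
  by (auto simp: pro_p_iwahori_def integral_points_def GL_integers_def integers_def mle_def
      rational_points_def)

lemma J_invE:
  assumes "A \<in> J"
  obtains B where "B \<in> J" "A ** B = mat 1" "B ** A = mat 1"
proof -
  obtain B where B: "mle 1 B" "A ** B = mat 1" "B ** A = mat 1" using assms by (auto simp: J_iff)
  have A: "mle 1 A" "map_matrix to_ac (map_matrix red A) \<in> N" using assms by (auto simp: J_iff)
  have "map_matrix to_ac (map_matrix red A) ** map_matrix to_ac (map_matrix red B) = mat 1"
    using A B by (simp add: map_red_1 flip: map_matrix_to_ac_mult map_red_mult)
  then have "map_matrix to_ac (map_matrix red B) \<in> N"
    using A subgroup.m_inv_closed[OF N] inv_GL by metis
  moreover have "B \<in> Q" using assms B Q_inv by (auto simp: J_iff)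
  ultimately have "B \<in> J" using A B by (auto simp: J_iff)
  then show ?thesis using that B by blast
qed

lemma subgroup_J: "subgroup J \<Gamma>"
proof (rule group.subgroupI[OF group_\<Gamma>])
  show "J \<subseteq> carrier \<Gamma>" by (auto simp: J_iff)
  have "mat 1 \<in> N" "mat 1 \<in> Q"
    using subgroup.one_closed[OF N] subgroup.one_closed[OF Q] by (auto simp: GL_def)
  then have "mat 1 \<in> J" by (auto simp: J_iff map_red_1 mle_mat intro!: exI[of _ "mat 1"])
  then show "J \<noteq> {}" by blast
  fix A assume A: "A \<in> J"
  then obtain B where B: "B \<in> J" "A ** B = mat 1" "B ** A = mat 1" by (rule J_invE)
  then have "inv\<^bsub>\<Gamma>\<^esub> A = B"
    using A by (intro group.inv_equality[OF group_\<Gamma>]) (auto simp: J_iff GL_def)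
  then show "inv\<^bsub>\<Gamma>\<^esub> A \<in> J" using B by simp
  fix C assume C: "C \<in> J"
  then obtain D where D: "D \<in> J" "C ** D = mat 1" "D ** C = mat 1" by (rule J_invE)
  have m: "mle 1 A" "mle 1 B" "mle 1 C" "mle 1 D" using A B C D by (auto simp: J_iff)
  have "A ** C ** (D ** B) = A ** (C ** D) ** B" "D ** B ** (A ** C) = D ** (B ** A) ** C"
    by (simp_all add: matrix_mul_assoc)
  then have inv: "A ** C ** (D ** B) = mat 1" "D ** B ** (A ** C) = mat 1" using B D by simp_all
  have "map_matrix to_ac (map_matrix red (A ** C)) \<in> N"
    using A C m subgroup.m_closed[OF N]
    by (auto simp: J_iff map_red_mult map_matrix_to_ac_mult GL_def)
  then show "A \<otimes>\<^bsub>\<Gamma>\<^esub> C \<in> J"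
    using A C inv m mle_mult_1[of D 1 B] mle_mult_1[of A 1 C] Q_mult
    by (auto simp: J_iff GL_def)
qed

text \<open>This is the openness of \<open>J\<close>: such matrices reduce to the identity. The
  inverse is bounded too because membership in \<open>J\<close> asks for an integral
  inverse.\<close>

lemma J_near_1:
  assumes "A \<in> Q" "A ** B = mat 1" "mle r (A - mat 1)" "mle r (B - mat 1)" "r < 1"
  shows "A \<in> J"
proof -
  have "mle 1 C" if "mle r (C - mat 1)" for C :: "'f^'n^'n"
    using mle_add[OF mle_mono[OF that] mle_mat[of 1 1]] assms(5) by simp
  then have m: "mle 1 A" "mle 1 B" using assms(3,4) by blast+
  have "map_matrix red A = mat 1"
    using map_red_eq_1[OF m(1)] assms(3,5) by (auto simp: mle_def intro: le_less_trans)
  moreover have "mat 1 \<in> N" using subgroup.one_closed[OF N] by (simp add: GL_def)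
  moreover have "B ** A = mat 1" using assms(2) by (simp add: matrix_left_right_inverse)
  ultimately show ?thesis using assms m by (auto simp: J_iff)
qed

text \<open>\<open>A\<close> fixes gJ as soon as its conjugate by the inverse of \<open>g\<close>
  lies in \<open>J\<close>, and conjugation enlarges the distance to 1 at most by the norms of
  \<open>g\<close> and its inverse.\<close>

lemma coset_fixed:
  assumes g: "g \<in> Q"
  shows "\<exists>e>0. \<forall>A\<in>J. mle e (A - mat 1) \<longrightarrow> A <#\<^bsub>\<Gamma>\<^esub> (g <#\<^bsub>\<Gamma>\<^esub> J) = g <#\<^bsub>\<Gamma>\<^esub> J"
proof -
  interpret \<Gamma>: group \<Gamma> by (rule group_\<Gamma>)
  interpret J: subgroup J \<Gamma> by (rule subgroup_J)
  obtain h where h: "h \<in> Q" "g ** h = mat 1" "h ** g = mat 1" using g by (rule Q_invE)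
  obtain i j k l where "mle (v (g $ i $ j)) g" "mle (v (h $ k $ l)) h"
    using mle_attained[of g] mle_attained[of h] by blast
  then obtain s where s: "1 \<le> s" "mle s g" "mle s h"
    using that[of "max 1 (max (v (g $ i $ j)) (v (h $ k $ l)))"]
    by (meson max.cobounded1 max.cobounded2 mle_mono order_trans)
  \<comment> \<open>Chosen so that s * e * s = 1/2, a radius below 1 as \<open>J_near_1\<close>
    requires.\<close>
  define e where "e = 1 / (2 * s * s)"
  have e: "0 < e" "s * e * s = 1 / 2" using s by (auto simp: e_def)
  show ?thesis
  proof (intro exI[of _ e] conjI ballI impI e)
    fix A assume A: "A \<in> J" and Ae: "mle e (A - mat 1)"
    obtain B where B: "B \<in> J" "A ** B = mat 1" "B ** A = mat 1" using A by (rule J_invE)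
    have AQ: "A \<in> Q" using A by (simp add: J_iff)
    \<comment> \<open>Integrality of the inverse \<open>B\<close> passes the bound from
      \<open>A\<close> to \<open>B\<close>.\<close>
    have "B - mat 1 = B ** (mat 1 - A)" using B(3) by (simp add: matrix_diff_ldistrib)
    moreover have "mle e (mat 1 - A)" using Ae mle_minus[of e A] by simp
    moreover have "mle 1 B" using B by (simp add: J_iff)
    ultimately have Be: "mle e (B - mat 1)" using mle_mult_1[of B e "mat 1 - A"] e by simp
    have conj: "mle (1 / 2) (h ** C ** g - mat 1)" if "mle e (C - mat 1)" for C
    proof -
      have "h ** C ** g - mat 1 = h ** (C - mat 1) ** g"
        using h by (simp add: matrix_diff_ldistrib matrix_diff_rdistrib)
      then show ?thesis
        using mle_mult[OF mle_mult[OF s(3) that] s(2)] s e by simp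
    qed
    have "h ** A ** g ** (h ** B ** g) = h ** A ** (g ** h) ** B ** g"
      by (simp add: matrix_mul_assoc)
    also have "\<dots> = h ** (A ** B) ** g" using h by (simp add: matrix_mul_assoc)
    finally have inv: "h ** A ** g ** (h ** B ** g) = mat 1" using h B by simp
    have Y: "h ** A ** g \<in> J"
      by (rule J_near_1[OF _ inv conj[OF Ae] conj[OF Be]]) (use g h AQ Q_mult in auto)
    have "A ** g = g ** h ** A ** g" using h by simp
    then have eq: "A \<otimes>\<^bsub>\<Gamma>\<^esub> g = g \<otimes>\<^bsub>\<Gamma>\<^esub> (h ** A ** g)" by (simp add: GL_def matrix_mul_assoc)
    have "A <#\<^bsub>\<Gamma>\<^esub> (g <#\<^bsub>\<Gamma>\<^esub> J) = (A \<otimes>\<^bsub>\<Gamma>\<^esub> g) <#\<^bsub>\<Gamma>\<^esub> J"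
      using AQ g J.subset by (intro \<Gamma>.lcos_m_assoc) auto
    also have "\<dots> = (g \<otimes>\<^bsub>\<Gamma>\<^esub> (h ** A ** g)) <#\<^bsub>\<Gamma>\<^esub> J"
      by (simp only: eq)
    also have "\<dots> = g <#\<^bsub>\<Gamma>\<^esub> ((h ** A ** g) <#\<^bsub>\<Gamma>\<^esub> J)"
      using g Y J.subset by (intro \<Gamma>.lcos_m_assoc[symmetric]) auto
    also have "(h ** A ** g) <#\<^bsub>\<Gamma>\<^esub> J = J"
      using Y J.subset by (intro \<Gamma>.coset_join3 subgroup_J) auto
    finally show "A <#\<^bsub>\<Gamma>\<^esub> (g <#\<^bsub>\<Gamma>\<^esub> J) = g <#\<^bsub>\<Gamma>\<^esub> J" .
  qed
qed

text \<open>Cover the integers by finitely many balls of radius \<open>e\<close>. If the entries of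
  \<open>A\<close> and \<open>B\<close> share their ball centres, the inverse of \<open>A\<close>
  times \<open>B\<close> is close enough to 1 to fix \<open>c\<close>, so the image of
  \<open>c\<close> depends only on the pattern \<open>f A\<close>, for which there are finitely many
  choices.\<close>

lemma finite_coset_orbit:
  assumes c: "c \<in> lcosets\<^bsub>\<Gamma>\<^esub> J"
  shows "finite ((\<lambda>A. A <#\<^bsub>\<Gamma>\<^esub> c) ` J)"
proof -
  interpret \<Gamma>: group \<Gamma> by (rule group_\<Gamma>)
  interpret J: subgroup J \<Gamma> by (rule subgroup_J)
  obtain g where g: "g \<in> Q" "c = g <#\<^bsub>\<Gamma>\<^esub> J" using c by (auto simp: LCOSETS_def)
  obtain e where e: "e > 0" "\<And>A. \<lbrakk>A \<in> J; mle e (A - mat 1)\<rbrakk> \<Longrightarrow> A <#\<^bsub>\<Gamma>\<^esub> c = c"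
    using coset_fixed[OF g(1)] g(2) by blast
  obtain T where T: "finite T" "\<And>x. v x \<le> 1 \<Longrightarrow> \<exists>t\<in>T. v (x - t) < e"
    using finite_net[OF e(1)] by blast
  then obtain t where t: "\<And>x. v x \<le> 1 \<Longrightarrow> t x \<in> T" "\<And>x. v x \<le> 1 \<Longrightarrow> v (x - t x) < e" by metis
  define f where "f A = (\<lambda>ij\<in>UNIV. t (A $ fst ij $ snd ij))" for A :: "'f^'n^'n"
  have "f ` J \<subseteq> UNIV \<rightarrow>\<^sub>E T" using t(1) by (auto simp: f_def J_iff mle_def)
  moreover have "finite ((UNIV :: ('n \<times> 'n) set) \<rightarrow>\<^sub>E T)" using T(1) by (intro finite_PiE) simp_all
  ultimately have fin: "finite (f ` J)" by (rule finite_subset)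
  have eq: "A <#\<^bsub>\<Gamma>\<^esub> c = B <#\<^bsub>\<Gamma>\<^esub> c" if AB: "A \<in> J" "B \<in> J" "f A = f B" for A B
  proof -
    obtain A' where A': "A' \<in> J" "A ** A' = mat 1" "A' ** A = mat 1" using AB(1) by (rule J_invE)
    have "v ((B - A) $ i $ j) \<le> e" for i j
    proof -
      have eq: "t (A $ i $ j) = t (B $ i $ j)" using fun_cong[OF AB(3), of "(i, j)"] by (simp add: f_def)
      have "v (A $ i $ j) \<le> 1" "v (B $ i $ j) \<le> 1" using AB by (auto simp: J_iff mle_def)
      then have "v (A $ i $ j - t (A $ i $ j)) < e" "v (B $ i $ j - t (B $ i $ j)) < e"
        using t(2) by blast+
      then show ?thesis
        using v_diff[of "B $ i $ j - t (B $ i $ j)" "A $ i $ j - t (B $ i $ j)"] by (simp add: eq)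
    qed
    then have "mle e (B - A)" by (simp add: mle_def)
    moreover have "A' ** B - mat 1 = A' ** (B - A)" using A' by (simp add: matrix_diff_ldistrib)
    moreover have "mle 1 A'" using A' by (simp add: J_iff)
    ultimately have "mle e (A' ** B - mat 1)" using mle_mult_1[of A' e "B - A"] e(1) by simp
    moreover have "A' ** B \<in> J" using J.m_closed[OF A'(1) AB(2)] by (simp add: GL_def)
    ultimately have fixed: "(A' ** B) <#\<^bsub>\<Gamma>\<^esub> c = c" using e by blast
    have "c \<subseteq> carrier \<Gamma>" using J.lcosets_carrier[OF group_\<Gamma> c] .
    then have "A <#\<^bsub>\<Gamma>\<^esub> ((A' ** B) <#\<^bsub>\<Gamma>\<^esub> c) = (A \<otimes>\<^bsub>\<Gamma>\<^esub> (A' ** B)) <#\<^bsub>\<Gamma>\<^esub> c"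
      using AB \<open>A' ** B \<in> J\<close> J.subset by (intro \<Gamma>.lcos_m_assoc) auto
    also have "A \<otimes>\<^bsub>\<Gamma>\<^esub> (A' ** B) = B" using A' by (simp add: GL_def matrix_mul_assoc)
    finally show ?thesis using fixed by simp
  qed
  have "(\<lambda>A. A <#\<^bsub>\<Gamma>\<^esub> c) ` J \<subseteq> (\<lambda>y. inv_into J f y <#\<^bsub>\<Gamma>\<^esub> c) ` f ` J"
  proof
    fix y assume "y \<in> (\<lambda>A. A <#\<^bsub>\<Gamma>\<^esub> c) ` J"
    then obtain A where A: "A \<in> J" "y = A <#\<^bsub>\<Gamma>\<^esub> c" by blast
    then have "y = inv_into J f (f A) <#\<^bsub>\<Gamma>\<^esub> c"
      using eq[of A "inv_into J f (f A)"] by (simp add: f_inv_into_f inv_into_into)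
    then show "y \<in> (\<lambda>y. inv_into J f y <#\<^bsub>\<Gamma>\<^esub> c) ` f ` J" using A by blast
  qed
  then show ?thesis by (rule finite_subset[OF _ finite_imageI[OF fin]])
qed

text \<open>A first p-power makes the unipotent reduction trivial; the contraction then brings the
  matrix as near to 1 as desired, and the two exponents add.\<close>

lemma J_converges:
  assumes A: "A \<in> J" and e: "0 < e"
  shows "\<exists>M. mle e (mpow A (CHAR('q) ^ M) - mat 1)"
proof -
  let ?p = "CHAR('q)"
  have m: "mle 1 A" and N: "map_matrix to_ac (map_matrix red A) \<in> N" using A by (auto simp: J_iff)
  have "of_nat ?p = (0 :: 'q alg_closure)" by (metis CHAR_alg_closure of_nat_CHAR)
  then obtain a where "mpow (map_matrix to_ac (map_matrix red A)) (?p ^ a) = mat 1"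
    using unipotent_power[OF unip[OF N]] by blast
  then have "map_matrix to_ac (map_matrix red (mpow A (?p ^ a))) = map_matrix to_ac (mat 1)"
    using m by (simp add: mpow_map_matrix_to_ac map_red_mpow)
  then have "map_matrix red (mpow A (?p ^ a)) = mat 1" by (simp only: map_matrix_to_ac_eq_iff)
  then have lt: "\<forall>i j. v ((mpow A (?p ^ a) - mat 1) $ i $ j) < 1"
    using map_red_eq_1 mle_mpow[OF m] by blast
  obtain i j where "mle (v ((mpow A (?p ^ a) - mat 1) $ i $ j)) (mpow A (?p ^ a) - mat 1)"
    using mle_attained by blast
  then obtain M where "mle e (mpow (mpow A (?p ^ a)) (?p ^ M) - mat 1)"
    using mpow_converges[OF _ _ _ v_CHAR e] lt v_nonneg by blast
  then show ?thesis by (metis mpow_mult power_add)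
qed

text \<open>One exponent must serve all points of the orbit. As the orbit is finite, the minimum of
  their radii from \<open>coset_fixed\<close> is still positive.\<close>

lemma orbit_power:
  assumes c: "c \<in> lcosets\<^bsub>\<Gamma>\<^esub> J" and A: "A \<in> J"
  shows "\<exists>M. \<forall>y\<in>(\<lambda>A. A <#\<^bsub>\<Gamma>\<^esub> c) ` J. (A [^]\<^bsub>\<Gamma>\<^esub> (CHAR('q) ^ M)) <#\<^bsub>\<Gamma>\<^esub> y = y"
proof -
  interpret \<Gamma>: group \<Gamma> by (rule group_\<Gamma>)
  interpret J: subgroup J \<Gamma> by (rule subgroup_J)
  let ?E = "(\<lambda>A. A <#\<^bsub>\<Gamma>\<^esub> c) ` J"
  obtain g where g: "g \<in> Q" "c = g <#\<^bsub>\<Gamma>\<^esub> J" using c by (auto simp: LCOSETS_def)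
  have "\<exists>e>0. \<forall>B\<in>J. mle e (B - mat 1) \<longrightarrow> B <#\<^bsub>\<Gamma>\<^esub> y = y" if "y \<in> ?E" for y
  proof -
    obtain C where C: "C \<in> J" "y = C <#\<^bsub>\<Gamma>\<^esub> c" using \<open>y \<in> ?E\<close> by blast
    then have CQ: "C \<in> Q" using J.subset by auto
    have "y = (C \<otimes>\<^bsub>\<Gamma>\<^esub> g) <#\<^bsub>\<Gamma>\<^esub> J"
      unfolding C(2) g(2) using CQ g(1) J.subset by (intro \<Gamma>.lcos_m_assoc) auto
    moreover have "C \<otimes>\<^bsub>\<Gamma>\<^esub> g \<in> Q" using \<Gamma>.m_closed[of C g] CQ g by simp
    ultimately show ?thesis using coset_fixed by blast
  qed
  then obtain e where e: "\<And>y. y \<in> ?E \<Longrightarrow> 0 < e y"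
    "\<And>y B. \<lbrakk>y \<in> ?E; B \<in> J; mle (e y) (B - mat 1)\<rbrakk> \<Longrightarrow> B <#\<^bsub>\<Gamma>\<^esub> y = y" by metis
  have fin: "finite ?E" by (rule finite_coset_orbit[OF c])
  have ne: "?E \<noteq> {}" using A by blast
  have "0 < Min (e ` ?E)" using fin ne e(1) by (subst Min_gr_iff) auto
  then obtain M where M: "mle (Min (e ` ?E)) (mpow A (CHAR('q) ^ M) - mat 1)"
    using J_converges[OF A] by blast
  let ?B = "A [^]\<^bsub>\<Gamma>\<^esub> (CHAR('q) ^ M)"
  have "?B \<in> J"
    using monoid.nat_pow_closed[OF group.is_monoid[OF \<Gamma>.subgroup_imp_group[OF subgroup_J]], of A] A
    by (simp add: nat_pow_GL)
  moreover have "mle (e y) (?B - mat 1)" if "y \<in> ?E" for y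
    using M fin that by (auto simp: nat_pow_GL intro!: mle_mono[OF M] Min_le)
  ultimately show ?thesis using e(2) by blast
qed

lemma hecke_averaging:
  assumes k: "CHAR('k::field) \<noteq> CHAR('q)"
  shows "hecke_averaging TYPE('k) \<Gamma> J"
proof -
  interpret \<Gamma>: group \<Gamma> by (rule group_\<Gamma>)
  interpret J: subgroup J \<Gamma> by (rule subgroup_J)
  show ?thesis
  proof
    fix A B assume A: "A \<in> carrier \<Gamma>" and AB: "A \<otimes>\<^bsub>\<Gamma>\<^esub> B \<in> carrier \<Gamma>"
    then have "A \<in> Q" by simp
    then obtain C where C: "C \<in> Q" "C ** A = mat 1" by (rule Q_invE)
    \<comment> \<open>\<open>B\<close> is an arbitrary matrix, but cancelling \<open>A\<close> on
      the left recovers it from the product.\<close>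
    then have "B = C ** (A ** B)" by (simp add: matrix_mul_assoc)
    then show "B \<in> carrier \<Gamma>" using Q_mult[OF C(1), of "A ** B"] AB by (simp add: GL_def)
  next
    fix c assume c: "c \<in> lcosets\<^bsub>\<Gamma>\<^esub> J"
    let ?E = "(\<lambda>A. A <#\<^bsub>\<Gamma>\<^esub> c) ` J"
    show fin: "finite ?E" by (rule finite_coset_orbit[OF c])
    have "\<not> CHAR('k) dvd card ?E"
    proof
      assume dvd: "CHAR('k) dvd card ?E"
      \<comment> \<open>This settles characteristic 0, since 0 divides only 0 and the orbit is
        non-empty.\<close>
      moreover have "card ?E \<noteq> 0" using fin J.one_closed by auto
      ultimately have "CHAR('k) > 0" by (intro Nat.gr0I) auto
      then have l: "Factorial_Ring.prime CHAR('k)" by (rule prime_CHAR_semidom)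
      have p: "Factorial_Ring.prime CHAR('q)"
        by (rule prime_CHAR_semidom[OF finite_imp_CHAR_pos]) simp
      have "CHAR('k) = CHAR('q)"
        using \<Gamma>.prime_dvd_card_coset_orbit[OF subgroup_J J.lcosets_carrier[OF group_\<Gamma> c] fin l dvd p]
          orbit_power[OF c] by blast
      then show False using k by simp
    qed
    then show "of_nat (card ?E) \<noteq> (0::'k)" by (simp add: of_nat_eq_0_iff_char_dvd)
  qed
qed

end

theorem lemma1p8:
  fixes v :: "'f::field \<Rightarrow> real"
    and red :: "'f \<Rightarrow> 'q::{field,finite}"
    and G :: "('f alg_closure^'n::finite^'n) set"
    and B N :: "('q alg_closure^'n^'n) set"
  assumes "local_field v"
    and "residue_map v red"
    and "split_reductive to_ac G"
    and "hyperspecial_model v red G"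
    and "borel_subgroup B (special_fibre v red G)"
    and "defined_over to_ac B"
    and "unipotent_radical N B"
    and "CHAR('k::field) \<noteq> CHAR('q)"
  shows "rho TYPE('k) (GL\<lparr>carrier := rational_points to_ac G\<rparr>) (pro_p_iwahori v red G N)
           ` ind_dual TYPE('k) (GL\<lparr>carrier := rational_points to_ac G\<rparr>) (pro_p_iwahori v red G N)
         = hecke_dual TYPE('k) (GL\<lparr>carrier := rational_points to_ac G\<rparr>) (pro_p_iwahori v red G N)"
proof -
  have "subgroup G GL" "subgroup N GL" "\<forall>A\<in>N. unipotent A"
    using assms by (simp_all add: split_reductive_def conn_reductive_def conn_alg_group_def
        alg_group_def unipotent_radical_def normal_unipotent_def)
  then have "iwahori v red G N"
    using assms by (simp add: iwahori_def iwahori_axioms_def local_valuation_def)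
  then interpret hecke_averaging "TYPE('k)" "GL\<lparr>carrier := rational_points to_ac G\<rparr>"
      "pro_p_iwahori v red G N"
    using assms by (intro iwahori.hecke_averaging)
  show ?thesis by (rule rho_surj)
qed

end
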